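(* Let $A({\bf x},{\bf y})$ and $B({\bf x},{\bf y})$, with ${\bf x}=(x_1,x_2)$, ${\bf y}=(y_1,y_2)$, be analytic functions of ${\bf x}$ and ${\bf y}$ (for ${\bf x},{\bf y}$ in a neighbourhood of $[-1,1]\times\{0\}\subset\mathbb{R}^2$), with $A({\bf x},{\bf x})=-\frac{1}{2\pi}$, so that $\Phi({\bf x},{\bf y})=A({\bf x},{\bf y})\log|{\bf x}-{\bf y}|+B({\bf x},{\bf y})$. Write $A(x,y)=A((x,0),(y,0))$ and $$A''(x,y)=\left.\frac{\partial^2A({\bf x},{\bf y})}{\partial x_2\,\partial y_2}\right|_{{\bf x}=(x,0),\,{\bf y}=(y,0)},\qquad B''(x,y)=\left.\frac{\partial^2B({\bf x},{\bf y})}{\partial x_2\,\partial y_2}\right|_{{\bf x}=(x,0),\,{\bf y}=(y,0)}.$$ Let $\lambda\in\mathbb{R}$ and let $$\mathcal{R}=-2\,\mathrm{diag}\left(1,\tfrac12,\tfrac13,\tfrac14,\ldots\right):\ell^2_\lambda\to\ell^2_{\lambda+1}.$$ Then $$\left(\mathcal{H}'_{\mathbb{I}}[-\pi A]+\mathcal{S}_0\left(\mathcal{L}_{\mathbb{I}}[\pi A'']+\Sigma_{\mathbb{I}}[\pi B'']\right)\right)\mathcal{R}=I+\mathcal{K},$$ where $\mathcal{K}:\ell^2_\lambda\to\ell^2_\lambda$ is compact.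
   Context: For $\lambda\in\mathbb{R}$, $\ell^2_\lambda\subset\mathbb{C}^\infty$ is the Banach space of sequences ${\bf u}=(u_0,u_1,\ldots)$ with norm $\|{\bf u}\|_{\ell^2_\lambda}=\left(\sum_{k=0}^\infty|u_k|^2(k+1)^{2\lambda}\right)^{1/2}<\infty$. $\mathbb{I}=[-1,1]$. $T_n$ and $U_n=C^{(1)}_n$ are the Chebyshev polynomials of the first and second kinds. A sequence ${\bf u}$ represents the density $u(y)=\sum_nu_nU_n(y)\sqrt{1-y^2}$. $\mathcal{M}_0[a]$ and $\mathcal{M}_1[a]$ are the infinite matrices of multiplication by the function $a$ in the bases $(T_n)_{n\ge0}$ and $(U_n)_{n\ge0}$ respectively (sending coefficients of $g$ to coefficients of $ag$). $\mathcal{S}_0$ is the conversion matrix from $T_n$-coefficients to $U_n$-coefficients, determined by $T_0=U_0$, $T_1=\frac12U_1$, $T_n=\frac12(U_n-U_{n-2})$ for $n\ge2$. $\mathcal{H}'_{\mathbb{I}}=\mathrm{diag}(-1,-2,-3,\ldots)$, the matrix of the Hadamard finite-part operator $u\mapsto\frac1\pi\,\mathrm{f.p.}\!\int_{-1}^1\frac{u(y)}{(y-x)^2}\,dy$ from the basis $U_n\sqrt{1-y^2}$ to the basis $U_n$. $\mathcal{L}_{\mathbb{I}}$ is the matrix of $u\mapsto\frac1\pi\int_{-1}^1\log|y-x|\,u(y)\,dy$ from the basis $U_n\sqrt{1-y^2}$ to the basis $T_n$: $U_0\sqrt{1-y^2}\mapsto-\frac12\log2+\frac14T_2$, and $U_n\sqrt{1-y^2}\mapsto\frac12\left(\frac{T_{n+2}}{n+2}-\frac{T_n}{n}\right)$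 for $n\ge1$. $\Sigma_{\mathbb{I}}=(\frac12,0,0,\ldots)$ is the functional $u\mapsto\frac1\pi\int_{-1}^1u(y)\,dy$ in the basis $U_n\sqrt{1-y^2}$; its scalar value is identified with the $T_n$-coefficient sequence of the corresponding constant function, i.e. $\Sigma_{\mathbb{I}}{\bf u}=(\frac12u_0,0,0,\ldots)^\top$. For a bivariate kernel $K(x,y)=\sum_ia_i(x)b_i(y)$ (a finite sum, or for analytic $K$ its convergent bivariate Chebyshev expansion), $$\mathcal{H}'_{\mathbb{I}}[K]:=\sum_i\mathcal{M}_1[a_i]\mathcal{H}'_{\mathbb{I}}\mathcal{M}_1[b_i],\quad \mathcal{L}_{\mathbb{I}}[K]:=\sum_i\mathcal{M}_0[a_i]\mathcal{L}_{\mathbb{I}}\mathcal{M}_1[b_i],\quad \Sigma_{\mathbb{I}}[K]:=\sum_i\mathcal{M}_0[a_i]\Sigma_{\mathbb{I}}\mathcal{M}_1[b_i].$$ The operator in the claim represents $u\mapsto\frac{\partial}{\partial x_2}\int_{-1}^1\frac{\partial\Phi({\bf x},{\bf y})}{\partial y_2}u(y)\,dy$ on $[-1,1]\times\{0\}$, from the basis $U_n\sqrt{1-y^2}$ to the basis $U_n$. *)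

theory Defs
  imports "HOL-Analysis.Analysis"
begin

type_synonym cseq = "nat \<Rightarrow> complex"

definition l2w :: "real \<Rightarrow> cseq set" where
  "l2w l = {u. (\<lambda>k. (norm (u k))\<^sup>2 * (real k + 1) powr (2 * l)) summable_on UNIV}"

definition l2w_norm :: "real \<Rightarrow> cseq \<Rightarrow> real" where
  "l2w_norm l u = sqrt (\<Sum>\<^sub>\<infinity>k. (norm (u k))\<^sup>2 * (real k + 1) powr (2 * l))"

definition l2w_dist :: "real \<Rightarrow> cseq \<Rightarrow> cseq \<Rightarrow> real" where
  "l2w_dist l u v = l2w_norm l (\<lambda>k. u k - v k)"

lemma l2w_add_aux:
  assumes u: "u \<in> l2w l" and v: "v \<in> l2w l"
  shows l2w_add: "(\<lambda>k. u k + v k) \<in> l2w l"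
    and l2w_norm_triangle: "l2w_norm l (\<lambda>k. u k + v k) \<le> l2w_norm l u + l2w_norm l v"
proof -
  define w where "w = (\<lambda>k::nat. (real k + 1) powr l)"
  have w: "(real k + 1) powr (2 * l) = (w k)\<^sup>2" "w k \<ge> 0" for k
    by (simp_all add: w_def powr_power mult.commute)
  define e where "e = (\<lambda>(x::cseq) k. (norm (x k))\<^sup>2 * (real k + 1) powr (2 * l))"
  have e: "e x k = (norm (x k) * w k)\<^sup>2" "e x k \<ge> 0" for x k
    by (simp_all add: e_def w power_mult_distrib)
  have nrm: "l2w_norm l x = sqrt (\<Sum>\<^sub>\<infinity>k. e x k)" for x
    by (simp add: l2w_norm_def e_def)
  have mem: "x \<in> l2w l \<longleftrightarrow> e x summable_on UNIV" for x
    by (simp add: l2w_def e_def)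
  have fin: "L2_set (\<lambda>k. norm (x k) * w k) F \<le> l2w_norm l x"
    if "x \<in> l2w l" "finite F" for x F
  proof -
    have "sum (e x) F \<le> (\<Sum>\<^sub>\<infinity>k. e x k)"
      using that e by (intro finite_sum_le_infsum) (auto simp: mem)
    then show ?thesis by (simp add: L2_set_def nrm e)
  qed
  define s where "s = l2w_norm l u + l2w_norm l v"
  have s0: "s \<ge> 0"
    by (auto simp: s_def nrm intro!: add_nonneg_nonneg infsum_nonneg e)
  have bd: "sum (e (\<lambda>k. u k + v k)) F \<le> s\<^sup>2" if "finite F" for F
  proof -
    have "L2_set (\<lambda>k. norm (u k + v k) * w k) F
        \<le> L2_set (\<lambda>k. norm (u k) * w k + norm (v k) * w k) F"
      by (rule L2_set_mono)
        (auto simp: w simp flip: distrib_right intro!: mult_right_mono norm_triangle_ineq)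
    also have "\<dots> \<le> L2_set (\<lambda>k. norm (u k) * w k) F + L2_set (\<lambda>k. norm (v k) * w k) F"
      by (rule L2_set_triangle_ineq)
    also have "\<dots> \<le> s"
      unfolding s_def using fin[OF u that] fin[OF v that] by simp
    finally have "sqrt (sum (e (\<lambda>k. u k + v k)) F) \<le> s"
      by (simp add: L2_set_def e)
    then show ?thesis
      by (rule sqrt_le_D)
  qed
  show sm: "(\<lambda>k. u k + v k) \<in> l2w l"
    unfolding mem using e bd
    by (intro nonneg_bdd_above_summable_on bdd_aboveI2[where M = "s\<^sup>2"]) auto
  have "(\<Sum>\<^sub>\<infinity>k. e (\<lambda>k. u k + v k) k) \<le> s\<^sup>2"
    using sm bd unfolding mem by (intro infsum_le_finite_sums) auto
  then have "l2w_norm l (\<lambda>k. u k + v k) \<le> s"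
    unfolding nrm using s0 by (simp add: real_le_lsqrt)
  then show "l2w_norm l (\<lambda>k. u k + v k) \<le> l2w_norm l u + l2w_norm l v"
    by (simp add: s_def)
qed

lemma l2w_scale: "u \<in> l2w l \<Longrightarrow> (\<lambda>k. c * u k) \<in> l2w l"
  unfolding l2w_def
  by (auto simp: norm_mult power_mult_distrib mult.assoc intro!: summable_on_cmult_right)

lemma Metric_space_l2w: "Metric_space (l2w l) (l2w_dist l)"
proof
  fix x y z :: cseq
  show "0 \<le> l2w_dist l x y"
    by (auto simp: l2w_dist_def l2w_norm_def intro!: infsum_nonneg)
  show "l2w_dist l x y = l2w_dist l y x"
    by (simp add: l2w_dist_def l2w_norm_def norm_minus_commute)
  have diff: "(\<lambda>k. a k - b k) \<in> l2w l" if "a \<in> l2w l" "b \<in> l2w l" for a b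
    using l2w_add[OF that(1) l2w_scale[OF that(2), of "-1"]] by simp
  show "(l2w_dist l x y = 0) = (x = y)" if "x \<in> l2w l" "y \<in> l2w l"
  proof
    assume "l2w_dist l x y = 0"
    then have "(\<Sum>\<^sub>\<infinity>k. (norm (x k - y k))\<^sup>2 * (real k + 1) powr (2 * l)) = 0"
      by (simp add: l2w_dist_def l2w_norm_def)
    then have "(norm (x k - y k))\<^sup>2 * (real k + 1) powr (2 * l) = 0" for k
      using diff[OF that]
      by (intro nonneg_infsum_le_0D[where A = UNIV]) (auto simp: l2w_def)
    then have "x k = y k" for k
      by (auto dest!: meta_spec[of _ k])
    then show "x = y" by auto
  qed (simp add: l2w_dist_def l2w_norm_def)
  show "l2w_dist l x z \<le> l2w_dist l x y + l2w_dist l y z"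
    if "x \<in> l2w l" "y \<in> l2w l" "z \<in> l2w l"
    using l2w_norm_triangle[OF diff[OF that(1,2)] diff[OF that(2,3)]]
    by (simp add: l2w_dist_def)
qed

definition compact_operator_l2w :: "real \<Rightarrow> (cseq \<Rightarrow> cseq) \<Rightarrow> bool" where
  "compact_operator_l2w l T \<longleftrightarrow>
     (\<forall>u\<in>l2w l. T u \<in> l2w l) \<and>
     (\<forall>u\<in>l2w l. \<forall>v\<in>l2w l. T (\<lambda>k. u k + v k) = (\<lambda>k. T u k + T v k)) \<and>
     (\<forall>c. \<forall>u\<in>l2w l. T (\<lambda>k. c * u k) = (\<lambda>k. c * T u k)) \<and>
     (\<forall>S. Metric_space.mbounded (l2w l) (l2w_dist l) S \<longrightarrow>
        compactin (Metric_space.mtopology (l2w l) (l2w_dist l))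
          (Metric_space.mtopology (l2w l) (l2w_dist l) closure_of (T ` S)))"


fun cheb_T :: "nat \<Rightarrow> real \<Rightarrow> real" where
  "cheb_T 0 x = 1"
| "cheb_T (Suc 0) x = x"
| "cheb_T (Suc (Suc n)) x = 2 * x * cheb_T (Suc n) x - cheb_T n x"

fun cheb_U :: "nat \<Rightarrow> real \<Rightarrow> real" where
  "cheb_U 0 x = 1"
| "cheb_U (Suc 0) x = 2 * x"
| "cheb_U (Suc (Suc n)) x = 2 * x * cheb_U (Suc n) x - cheb_U n x"

text \<open>Coefficients of a function in the orthogonal bases \<open>T\<^sub>n\<close> (weight
  \<open>1 / sqrt (1 - x\<^sup>2)\<close>) and \<open>U\<^sub>n\<close> (weight \<open>sqrt (1 - x\<^sup>2)\<close>).\<close>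

definition T_coeff :: "(real \<Rightarrow> complex) \<Rightarrow> nat \<Rightarrow> complex" where
  "T_coeff f n = (if n = 0 then 1 else 2) / of_real pi *
     integral {-1..1} (\<lambda>x. f x * of_real (cheb_T n x / sqrt (1 - x\<^sup>2)))"

definition U_coeff :: "(real \<Rightarrow> complex) \<Rightarrow> nat \<Rightarrow> complex" where
  "U_coeff f n = 2 / of_real pi *
     integral {-1..1} (\<lambda>x. f x * of_real (cheb_U n x * sqrt (1 - x\<^sup>2)))"

text \<open>\<open>K(x,y) = \<Sum>p q. cheb2_coeff K p q T\<^sub>p(x) T\<^sub>q(y)\<close>.\<close>

definition cheb2_coeff :: "(real \<Rightarrow> real \<Rightarrow> complex) \<Rightarrow> nat \<Rightarrow> nat \<Rightarrow> complex" where
  "cheb2_coeff K p q = T_coeff (\<lambda>x. T_coeff (\<lambda>y. K x y) q) p"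


text \<open>Entry \<open>M m n\<close> of an infinite matrix: column \<open>n\<close> holds the coefficients of the image
  of the \<open>n\<close>-th basis function.\<close>

type_synonym imat = "nat \<Rightarrow> nat \<Rightarrow> complex"

definition mat_app :: "imat \<Rightarrow> cseq \<Rightarrow> cseq" where
  "mat_app M u = (\<lambda>m. \<Sum>\<^sub>\<infinity>n. M m n * u n)"

definition mult_T :: "(real \<Rightarrow> complex) \<Rightarrow> imat" where
  "mult_T a m n = T_coeff (\<lambda>x. a x * of_real (cheb_T n x)) m"

definition mult_U :: "(real \<Rightarrow> complex) \<Rightarrow> imat" where
  "mult_U a m n = U_coeff (\<lambda>x. a x * of_real (cheb_U n x)) m"

definition conv_TU :: imat where
  "conv_TU m n =
     (if m = n then (if n = 0 then 1 else 1 / 2)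
      else if n = m + 2 then - 1 / 2 else 0)"

definition hadamard_mat :: imat where
  "hadamard_mat m n = (if m = n then - (of_nat n + 1) else 0)"

definition log_mat :: imat where
  "log_mat m n =
     (if n = 0 then
        (if m = 0 then - of_real (ln 2) / 2 else if m = 2 then 1 / 4 else 0)
      else
        (if m = n + 2 then 1 / (2 * (of_nat n + 2))
         else if m = n then - 1 / (2 * of_nat n) else 0))"

definition sigma_mat :: imat where
  "sigma_mat m n = (if m = 0 \<and> n = 0 then 1 / 2 else 0)"

definition precond_mat :: imat where
  "precond_mat m n = (if m = n then - 2 / (of_nat n + 1) else 0)"

lemma precond_mat_app: "mat_app precond_mat u = (\<lambda>k. - 2 / (of_nat k + 1) * u k)"
proof
  fix m
  have "(\<Sum>\<^sub>\<infinity>n. precond_mat m n * u n) = (\<Sum>\<^sub>\<infinity>n\<in>{m}. precond_mat m n * u n)"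
    by (rule infsum_cong_neutral) (auto simp: precond_mat_def)
  then show "mat_app precond_mat u m = - 2 / (of_nat m + 1) * u m"
    by (simp add: mat_app_def precond_mat_def)
qed

lemma precond_l2w:
  assumes "u \<in> l2w l"
  shows "mat_app precond_mat u \<in> l2w (l + 1)"
proof -
  have *: "(norm (mat_app precond_mat u k))\<^sup>2 * (real k + 1) powr (2 * (l + 1))
      = 4 * ((norm (u k))\<^sup>2 * (real k + 1) powr (2 * l))" for k
  proof -
    have n: "norm (- 2 / (of_nat k + 1) :: complex) = 2 / (real k + 1)"
      using norm_of_nat[of "Suc k", where ?'a = complex]
      by (simp add: norm_divide add.commute del: norm_of_nat)
    have p: "(real k + 1) powr (2 * (l + 1)) = (real k + 1) powr (2 * l) * (real k + 1)\<^sup>2"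
      by (simp add: distrib_left powr_add)
    show ?thesis
      unfolding precond_mat_app norm_mult n p by (simp add: power_mult_distrib power_divide)
  qed
  show ?thesis
    using assms unfolding l2w_def mem_Collect_eq * by (rule summable_on_cmult_right)
qed


text \<open>The summand \<open>M[a] D M\<^sub>1[b] u\<close> belonging to the term
  \<open>a(x) b(y) = (cheb2_coeff K p q T\<^sub>p(x)) T\<^sub>q(y)\<close> of the bivariate Chebyshev expansion
  of \<open>K\<close>.\<close>

definition kernel_term ::
  "((real \<Rightarrow> complex) \<Rightarrow> imat) \<Rightarrow> imat \<Rightarrow> (real \<Rightarrow> real \<Rightarrow> complex) \<Rightarrow> cseq \<Rightarrow> nat \<times> nat \<Rightarrow> cseq"
where
  "kernel_term M D K u = (\<lambda>(p, q).
     mat_app (M (\<lambda>x. cheb2_coeff K p q * of_real (cheb_T p x)))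
       (mat_app D (mat_app (mult_U (\<lambda>y. of_real (cheb_T q y))) u)))"

definition kernel_converges ::
  "((real \<Rightarrow> complex) \<Rightarrow> imat) \<Rightarrow> imat \<Rightarrow> (real \<Rightarrow> real \<Rightarrow> complex) \<Rightarrow> cseq \<Rightarrow> bool"
where
  "kernel_converges M D K u \<longleftrightarrow> (\<forall>m. (\<lambda>pq. kernel_term M D K u pq m) summable_on UNIV)"

definition kernel_op ::
  "((real \<Rightarrow> complex) \<Rightarrow> imat) \<Rightarrow> imat \<Rightarrow> (real \<Rightarrow> real \<Rightarrow> complex) \<Rightarrow> cseq \<Rightarrow> cseq"
where
  "kernel_op M D K u = (\<lambda>m. \<Sum>\<^sub>\<infinity>pq. kernel_term M D K u pq m)"

abbreviation "hadamard_op \<equiv> kernel_op mult_U hadamard_mat"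
abbreviation "log_op \<equiv> kernel_op mult_T log_mat"
abbreviation "sigma_op \<equiv> kernel_op mult_T sigma_mat"


text \<open>Joint real analyticity on \<open>W \<times> W\<close>: locally the sum of a convergent power series in
  the four real coordinates.\<close>

definition analytic_pair_on ::
  "(real \<times> real \<Rightarrow> real \<times> real \<Rightarrow> complex) \<Rightarrow> (real \<times> real) set \<Rightarrow> bool"
where
  "analytic_pair_on F W \<longleftrightarrow>
     (\<forall>x1 x2 y1 y2. (x1, x2) \<in> W \<longrightarrow> (y1, y2) \<in> W \<longrightarrow>
       (\<exists>r>0. \<exists>c :: nat \<times> nat \<times> nat \<times> nat \<Rightarrow> complex.
         \<forall>h1 h2 k1 k2. \<bar>h1\<bar> < r \<longrightarrow> \<bar>h2\<bar> < r \<longrightarrow> \<bar>k1\<bar> < r \<longrightarrow> \<bar>k2\<bar> < r \<longrightarrow>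
           ((\<lambda>(i, j, m, n). c (i, j, m, n) * of_real (h1 ^ i * h2 ^ j * k1 ^ m * k2 ^ n))
              has_sum F (x1 + h1, x2 + h2) (y1 + k1, y2 + k2)) UNIV))"

definition on_line :: "(real \<times> real \<Rightarrow> real \<times> real \<Rightarrow> complex) \<Rightarrow> real \<Rightarrow> real \<Rightarrow> complex" where
  "on_line F x y = F (x, 0) (y, 0)"

definition d2_on_line :: "(real \<times> real \<Rightarrow> real \<times> real \<Rightarrow> complex) \<Rightarrow> real \<Rightarrow> real \<Rightarrow> complex" where
  "d2_on_line F x y =
     vector_derivative (\<lambda>s. vector_derivative (\<lambda>t. F (x, s) (y, t)) (at 0)) (at 0)"

end

theory Submission
  imports Defs
begin

text \<open>
  With \<open>K = -\<pi> A\<close>, expand \<open>K = \<Sum> c\<^sub>p\<^sub>q T\<^sub>p(x) T\<^sub>q(y)\<close>. Up to a factor, \<open>\<R>\<close> is the inverse of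
  \<open>\<H>'\<close>, so commuting \<open>\<R>\<close> past \<open>\<M>\<^sub>1[T\<^sub>q]\<close> turns \<open>\<H>'[K] \<R>\<close> into
  \<open>2 \<Sum> c\<^sub>p\<^sub>q \<M>\<^sub>1[T\<^sub>p] \<M>\<^sub>1[T\<^sub>q] = 2 \<M>\<^sub>1[K(x,x)] = I\<close> plus commutator terms. These, and all terms of the
  logarithmic and the smooth part, are banded matrices of bandwidth \<open>p + q + 2\<close> whose \<open>(m,n)\<close> entry is at
  most a polynomial in \<open>p, q\<close> times \<open>1 / (n + 1)\<close>. Since the \<open>c\<^sub>p\<^sub>q\<close> decay faster than any power (the
  \<open>T\<^sub>n\<close> are eigenfunctions of a second-order operator preserving analytic kernels), the sum of these terms maps
  the unit ball of \<open>\<ell>\<^sup>2\<^sub>\<lambda>\<close> into a Hilbert cube \<open>{v. |v\<^sub>k| \<le> C (k + 1) powr (-\<lambda> - 1)}\<close>, which is compact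
  in \<open>\<ell>\<^sup>2\<^sub>\<lambda>\<close>.
\<close>

subsection \<open>Chebyshev coefficients as trigonometric integrals\<close>

text \<open>Since \<open>l\<close> is an arbitrary real, a band of width w distorts the weight (k +
  1)^l by a factor of up to (w + 1)^|l|. All losses are therefore polynomial in p + q, but of a
  degree that grows with |l|; this is why decay beyond every power is the right target for the
  coefficients. Each factor of decay costs two derivatives and an integration by parts. The
  eigenvalues 1 + n^2 never vanish, so p = 0 and q = 0 need no separate treatment.

  Just one term has no gain, the double sum of M_1[T_p] M_1[T_q]. It cannot be estimated away and
  has to be summed exactly: M_1 is multiplicative, and the series becomes the Chebyshev expansion of
  the kernel on the diagonal, where K = 1/2. The factor 2 in front is the product of the diagonal
  entries -(n + 1) and -2/(n + 1).

  Sequences enter the estimates only through |u_n| \<le> ||u|| (n + 1)^(-l). This gives away half a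
  power of n, and the gain of one whole power in the remaining terms more than pays for it.\<close>

lemma cheb_T_cos: "cheb_T n (cos t) = cos (real n * t)"
proof (induction n "cos t" rule: cheb_T.induct)
  case (3 n)
  have "cos (real (Suc (Suc n)) * t) + cos (real n * t) = 2 * cos t * cos (real (Suc n) * t)"
    using cos_plus_cos[of "real (Suc (Suc n)) * t" "real n * t"]
    by (simp add: algebra_simps add_divide_distrib)
  with 3 show ?case by simp
qed simp_all

lemma cheb_U_cos: "cheb_U n (cos t) * sin t = sin ((real n + 1) * t)"
proof (induction n "cos t" rule: cheb_U.induct)
  case 2
  show ?case using sin_double[of t] by (simp add: mult.commute)
next
  case (3 n)
  have "sin ((real (Suc (Suc n)) + 1) * t) + sin ((real n + 1) * t)
      = 2 * cos t * sin ((real (Suc n) + 1) * t)"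
    using sin_plus_sin[of "(real (Suc (Suc n)) + 1) * t" "(real n + 1) * t"]
    by (simp add: algebra_simps add_divide_distrib)
  moreover have "cheb_U (Suc (Suc n)) (cos t) * sin t
      = 2 * cos t * (cheb_U (Suc n) (cos t) * sin t) - cheb_U n (cos t) * sin t"
    by (simp add: algebra_simps)
  ultimately show ?case using 3 by simp
qed simp_all

lemma continuous_on_cheb_T [continuous_intros]:
  "continuous_on S f \<Longrightarrow> continuous_on S (\<lambda>x. cheb_T n (f x))"
  by (induction n rule: induct_nat_012) (auto intro!: continuous_intros)

lemma cheb_T_bound: "\<bar>x\<bar> \<le> 1 \<Longrightarrow> \<bar>cheb_T n x\<bar> \<le> 1"
  using cheb_T_cos[of n "arccos x"] by (simp add: abs_le_iff)

text \<open>The substitution x = cos t. The integrand is singular at both end points, but the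
  primitive \<open>- F (arccos x)\<close> is continuous up to them, so the fundamental theorem with
  derivatives in the interior applies.\<close>

lemma has_integral_arccos:
  fixes f :: "real \<Rightarrow> 'a::banach"
  assumes f: "continuous_on {0..pi} f"
  shows "((\<lambda>x. (1 / sqrt (1 - x\<^sup>2)) *\<^sub>R f (arccos x)) has_integral integral {0..pi} f) {-1..1}"
proof -
  define F where "F = (\<lambda>t. integral {0..t} f)"
  have F: "(F has_vector_derivative f t) (at t)" if "t \<in> {0<..<pi}" for t
    using integral_has_vector_derivative[OF f, of t] that at_within_Icc_at[of 0 t pi]
    by (simp add: F_def)
  have contF: "continuous_on {0..pi} F"
    unfolding F_def by (intro indefinite_integral_continuous_1 integrable_continuous_real f)
  have "((\<lambda>x. (1 / sqrt (1 - x\<^sup>2)) *\<^sub>R f (arccos x)) has_integral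
      (- F (arccos 1)) - (- F (arccos (-1)))) {-1..1}"
  proof (rule fundamental_theorem_of_calculus_interior)
    show "continuous_on {-1..1} (\<lambda>x. - F (arccos x))"
      by (intro continuous_intros continuous_on_compose2[OF contF])
        (auto intro: arccos_lbound arccos_ubound)
    fix x :: real assume x: "x \<in> {-1<..<1}"
    have "(arccos has_vector_derivative inverse (- sqrt (1 - x\<^sup>2))) (at x)"
      using DERIV_arccos[of x] x by (simp add: has_real_derivative_iff_has_vector_derivative)
    from vector_diff_chain_at[OF this F]
    have "((F \<circ> arccos) has_vector_derivative inverse (- sqrt (1 - x\<^sup>2)) *\<^sub>R f (arccos x)) (at x)"
      using arccos_lt_bounded[of x] x by auto
    from has_vector_derivative_minus[OF this]
    show "((\<lambda>x. - F (arccos x)) has_vector_derivative (1 / sqrt (1 - x\<^sup>2)) *\<^sub>R f (arccos x)) (at x)"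
      by (simp add: o_def divide_inverse)
  qed simp
  then show ?thesis by (simp add: F_def)
qed

lemma continuous_on_cos_comp:
  "continuous_on {-1..1} f \<Longrightarrow> continuous_on S (\<lambda>t. f (cos t))"
  for f :: "real \<Rightarrow> 'a::topological_space"
  by (rule continuous_on_compose2[of _ f]) (auto intro!: continuous_intros)

lemma T_coeff_cos:
  assumes f: "continuous_on {-1..1} f"
  shows "T_coeff f n = (if n = 0 then 1 else 2) / of_real pi *
     integral {0..pi} (\<lambda>t. f (cos t) * of_real (cos (real n * t)))"
proof -
  have "((\<lambda>x. (1 / sqrt (1 - x\<^sup>2)) *\<^sub>R (f (cos (arccos x)) * of_real (cos (real n * arccos x))))
     has_integral integral {0..pi} (\<lambda>t. f (cos t) * of_real (cos (real n * t)))) {-1..1}"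
    by (rule has_integral_arccos) (intro continuous_intros continuous_on_cos_comp[OF f])
  then have "((\<lambda>x. f x * of_real (cheb_T n x / sqrt (1 - x\<^sup>2)))
     has_integral integral {0..pi} (\<lambda>t. f (cos t) * of_real (cos (real n * t)))) {-1..1}"
    by (rule has_integral_eq[rotated])
      (simp add: cheb_T_cos[symmetric] scaleR_conv_of_real)
  then show ?thesis
    by (simp add: T_coeff_def integral_unique)
qed

lemma U_coeff_sin:
  assumes f: "continuous_on {-1..1} f"
  shows "U_coeff (\<lambda>x. f x * of_real (cheb_U n x)) m = 2 / of_real pi *
     integral {0..pi} (\<lambda>t. f (cos t) * of_real (sin ((real n + 1) * t) * sin ((real m + 1) * t)))"
proof -
  let ?I = "integral {0..pi} (\<lambda>t. f (cos t) * of_real (sin ((real n + 1) * t) * sin ((real m + 1) * t)))"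
  have "((\<lambda>x. (1 / sqrt (1 - x\<^sup>2)) *\<^sub>R (f (cos (arccos x)) *
      of_real (sin ((real n + 1) * arccos x) * sin ((real m + 1) * arccos x)))) has_integral ?I) {-1..1}"
    by (rule has_integral_arccos) (intro continuous_intros continuous_on_cos_comp[OF f])
  then have "((\<lambda>x. f x * of_real (cheb_U n x) * of_real (cheb_U m x * sqrt (1 - x\<^sup>2)))
     has_integral ?I) {-1..1}"
  proof (rule has_integral_eq[rotated])
    fix x :: real assume x: "x \<in> {-1..1}"
    have s: "sin (arccos x) = sqrt (1 - x\<^sup>2)"
      using x by (intro sin_arccos_abs) auto
    \<comment> \<open>At the end points the square root is 0 and both sides vanish, the left one
      because division by 0 yields 0.\<close>
    have "1 / sqrt (1 - x\<^sup>2) * (sin ((real n + 1) * arccos x) * sin ((real m + 1) * arccos x))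
       = cheb_U n x * (cheb_U m x * sqrt (1 - x\<^sup>2))"
      using x unfolding cheb_U_cos[symmetric] s by (cases "sqrt (1 - x\<^sup>2) = 0") (simp_all del: real_sqrt_eq_0_iff)
    moreover have "(1 / sqrt (1 - x\<^sup>2)) *\<^sub>R (f (cos (arccos x)) *
      of_real (sin ((real n + 1) * arccos x) * sin ((real m + 1) * arccos x)))
      = f (cos (arccos x)) * of_real (1 / sqrt (1 - x\<^sup>2) * (sin ((real n + 1) * arccos x) * sin ((real m + 1) * arccos x)))"
      by (simp add: scaleR_conv_of_real)
    moreover have "cos (arccos x) = x" using x by simp
    ultimately show "(1 / sqrt (1 - x\<^sup>2)) *\<^sub>R (f (cos (arccos x)) *
      of_real (sin ((real n + 1) * arccos x) * sin ((real m + 1) * arccos x)))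
      = f x * of_real (cheb_U n x) * of_real (cheb_U m x * sqrt (1 - x\<^sup>2))"
      by (simp only: mult.assoc of_real_mult)
  qed
  then show ?thesis
    by (simp add: U_coeff_def integral_unique)
qed

lemma T_coeff_cong:
  "(\<And>x. x \<in> {-1..1} \<Longrightarrow> f x = g x) \<Longrightarrow> T_coeff f n = T_coeff g n"
  unfolding T_coeff_def by (intro arg_cong2[where f = "(*)"] refl integral_cong) simp

lemma T_coeff_cmult: "T_coeff (\<lambda>x. c * f x) n = c * T_coeff f n"
  unfolding T_coeff_def mult.assoc integral_mult_right by (simp only: mult.left_commute)

lemma U_coeff_cmult: "U_coeff (\<lambda>x. c * f x) n = c * U_coeff f n"
  unfolding U_coeff_def mult.assoc integral_mult_right by (simp only: mult.left_commute)

lemma T_coeff_diff: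
  assumes "continuous_on {-1..1} f" "continuous_on {-1..1} g"
  shows "T_coeff (\<lambda>x. f x - g x) n = T_coeff f n - T_coeff g n"
proof -
  have "integral {0..pi} (\<lambda>t. (f (cos t) - g (cos t)) * of_real (cos (real n * t)))
     = integral {0..pi} (\<lambda>t. f (cos t) * of_real (cos (real n * t)))
     - integral {0..pi} (\<lambda>t. g (cos t) * of_real (cos (real n * t)))"
    unfolding left_diff_distrib
    by (intro integral_diff integrable_continuous_real continuous_intros assms[THEN continuous_on_cos_comp])
  then show ?thesis
    using assms by (simp add: T_coeff_cos continuous_on_diff right_diff_distrib)
qed

lemma T_coeff_bound:
  assumes f: "continuous_on {-1..1} f" and B: "\<And>x. x \<in> {-1..1} \<Longrightarrow> norm (f x) \<le> B"
  shows "norm (T_coeff f n) \<le> 2 * B"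
proof -
  have B0: "B \<ge> 0" using order_trans[OF norm_ge_zero B[of 0]] by simp
  have "norm (integral {0..pi} (\<lambda>t. f (cos t) * of_real (cos (real n * t)))) \<le> B * (pi - 0)"
  proof (rule integral_bound)
    fix t :: real
    have "norm (f (cos t)) * \<bar>cos (real n * t)\<bar> \<le> B * 1"
      by (intro mult_mono B B0) auto
    then show "norm (f (cos t) * of_real (cos (real n * t))) \<le> B" by (simp add: norm_mult)
  qed (auto intro!: continuous_intros continuous_on_cos_comp[OF f])
  then have I: "norm (integral {0..pi} (\<lambda>t. f (cos t) * of_real (cos (real n * t)))) \<le> B * pi" by simp
  have "norm (T_coeff f n) \<le> 2 / pi * (B * pi)"
    unfolding T_coeff_cos[OF f] norm_mult by (intro mult_mono I) (auto simp: norm_divide field_simps)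
  then show ?thesis by simp
qed

section \<open>Trigonometric moments\<close>

lemma has_integral_cos_int:
  "((\<lambda>t. cos (of_int k * t)) has_integral pi * of_bool (k = 0)) {0..pi}"
proof (cases "k = 0")
  case True
  then show ?thesis using has_integral_const_real[of "1::real" 0 pi] by simp
next
  case False
  have "((\<lambda>t. cos (of_int k * t)) has_integral sin (of_int k * pi) / of_int k - sin (of_int k * 0) / of_int k) {0..pi}"
    using False by (intro fundamental_theorem_of_calculus)
      (auto intro!: derivative_eq_intros simp: has_real_derivative_iff_has_vector_derivative[symmetric])
  moreover have "sin (of_int k * pi) = 0"
    using sin_zero_iff_int2 by blast
  ultimately show ?thesis using False by simp
qed

text \<open>Product-to-sum leaves four integer frequencies, of which only a zero one survives
  integration. Frequencies are integers so that differences of indices are not truncated.\<close>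

lemma has_integral_cos_cos_cos:
  "((\<lambda>t. cos (of_int a * t) * cos (of_int b * t) * cos (of_int c * t)) has_integral
     pi / 4 * (of_bool (a + b + c = 0) + of_bool (a + b - c = 0) + of_bool (a - b + c = 0)
       + of_bool (a - b - c = 0))) {0..pi}"
proof -
  have "((\<lambda>t. (1/4) * (cos (of_int (a + b + c) * t) + cos (of_int (a + b - c) * t)
      + cos (of_int (a - b + c) * t) + cos (of_int (a - b - c) * t))) has_integral
     (1/4) * (pi * of_bool (a + b + c = 0) + pi * of_bool (a + b - c = 0)
      + pi * of_bool (a - b + c = 0) + pi * of_bool (a - b - c = 0))) {0..pi}"
    by (intro has_integral_mult_right has_integral_add has_integral_cos_int)
  moreover have "cos (of_int a * t) * cos (of_int b * t) * cos (of_int c * t) =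
    (1/4) * (cos (of_int (a + b + c) * t) + cos (of_int (a + b - c) * t)
      + cos (of_int (a - b + c) * t) + cos (of_int (a - b - c) * t))" for t :: real
    by (simp add: distrib_right left_diff_distrib cos_add cos_diff sin_add sin_diff field_simps)
  moreover have "(1/4) * (pi * x1 + pi * x2 + pi * x3 + pi * x4) = pi / 4 * (x1 + x2 + x3 + x4)" for x1 x2 x3 x4
    by (simp add: algebra_simps)
  ultimately show ?thesis by (simp only:)
qed

lemma has_integral_cos_sin_sin:
  "((\<lambda>t. cos (of_int a * t) * (sin (of_int b * t) * sin (of_int c * t))) has_integral
     pi / 4 * (of_bool (a + b - c = 0) + of_bool (a - b + c = 0) - of_bool (a + b + c = 0)
       - of_bool (a - b - c = 0))) {0..pi}"
proof -
  have "((\<lambda>t. (1/4) * (cos (of_int (a + b - c) * t) + cos (of_int (a - b + c) * t)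
      - cos (of_int (a + b + c) * t) - cos (of_int (a - b - c) * t))) has_integral
     (1/4) * (pi * of_bool (a + b - c = 0) + pi * of_bool (a - b + c = 0)
      - pi * of_bool (a + b + c = 0) - pi * of_bool (a - b - c = 0))) {0..pi}"
    by (intro has_integral_mult_right has_integral_add has_integral_diff has_integral_cos_int)
  moreover have "cos (of_int a * t) * (sin (of_int b * t) * sin (of_int c * t)) =
    (1/4) * (cos (of_int (a + b - c) * t) + cos (of_int (a - b + c) * t)
      - cos (of_int (a + b + c) * t) - cos (of_int (a - b - c) * t))" for t :: real
    by (simp add: distrib_right left_diff_distrib cos_add cos_diff sin_add sin_diff field_simps)
  moreover have "(1/4) * (pi * x1 + pi * x2 - pi * x3 - pi * x4) = pi / 4 * (x1 + x2 - x3 - x4)" for x1 x2 x3 x4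
    by (simp add: algebra_simps)
  ultimately show ?thesis by (simp only:)
qed

text \<open>The index type is arbitrary because the interchange is used for single series over
  \<open>nat\<close> as well as for double series over pairs.\<close>

lemma has_sum_integral_Weierstrass:
  fixes f :: "'i \<Rightarrow> real \<Rightarrow> 'a::banach"
  assumes cont: "\<And>i. continuous_on {a..b} (f i)"
    and bound: "\<And>i x. x \<in> {a..b} \<Longrightarrow> norm (f i x) \<le> M i"
    and M: "M summable_on UNIV"
    and g: "\<And>x. x \<in> {a..b} \<Longrightarrow> ((\<lambda>i. f i x) has_sum g x) UNIV"
  shows "((\<lambda>i. integral {a..b} (f i)) has_sum integral {a..b} g) UNIV"
    and "continuous_on {a..b} g"
proof -
  have lim: "uniform_limit {a..b} (\<lambda>X x. \<Sum>i\<in>X. f i x) g (finite_subsets_at_top UNIV)"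
    by (rule Weierstrass_m_test_general') (use assms in auto)
  show "continuous_on {a..b} g"
    by (rule uniform_limit_theorem[OF _ lim]) (auto intro!: always_eventually continuous_intros cont)
  obtain I J where I: "\<And>X. ((\<lambda>x. \<Sum>i\<in>X. f i x) has_integral I X) {a..b}"
    and J: "(g has_integral J) {a..b}" and IJ: "(I \<longlongrightarrow> J) (finite_subsets_at_top UNIV)"
  proof (rule uniform_limit_integral[OF lim])
    show "continuous_on {a..b} (\<lambda>x. \<Sum>i\<in>X. f i x)" for X
      by (intro continuous_intros cont)
  qed auto
  have "I X = (\<Sum>i\<in>X. integral {a..b} (f i))" if "finite X" for X
    using integral_unique[OF I[of X]] that
    by (simp add: integral_sum integrable_continuous_real cont)
  then have "\<forall>\<^sub>F X in finite_subsets_at_top UNIV. I X = (\<Sum>i\<in>X. integral {a..b} (f i))"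
    by (intro eventually_finite_subsets_at_top_weakI)
  from tendsto_cong[OF this] IJ
  show "((\<lambda>i. integral {a..b} (f i)) has_sum integral {a..b} g) UNIV"
    by (simp add: has_sum_def integral_unique[OF J])
qed

text \<open>Chebyshev's equation: in \<open>x = cos t\<close> the operator on the left is \<open>1 - d\<^sup>2/dt\<^sup>2\<close>; the boundary terms
  vanish because \<open>sin 0 = sin pi = 0\<close>.\<close>

lemma T_coeff_eigen:
  assumes d1: "\<And>x. x \<in> {-1..1} \<Longrightarrow> (f has_vector_derivative f' x) (at x)"
    and d2: "\<And>x. x \<in> {-1..1} \<Longrightarrow> (f' has_vector_derivative f'' x) (at x)"
    and c: "continuous_on {-1..1} f''"
  shows "T_coeff (\<lambda>x. f x - (1 - of_real x ^ 2) * f'' x + of_real x * f' x) n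
       = (1 + of_nat n ^ 2) * T_coeff f n"
proof -
  have cf: "continuous_on {-1..1} f" and cf': "continuous_on {-1..1} f'"
    by (auto intro!: continuous_at_imp_continuous_on has_vector_derivative_continuous d1 d2)
  \<comment> \<open>With g t = f (cos t), this is g' cos (n t) + n g sin (n t), the boundary term of
    two integrations by parts; its derivative is (g'' + n^2 g) cos (n t).\<close>
  define G where "G = (\<lambda>t::real. of_real (- sin t * cos (n * t)) * f' (cos t) + of_real (n * sin (n * t)) * f (cos t))"
  define G' where "G' = (\<lambda>t::real. (of_real (sin t ^ 2) * f'' (cos t) - of_real (cos t) * f' (cos t)
        + of_nat n ^ 2 * f (cos t)) * of_real (cos (n * t)))"
  have "(G' has_integral G pi - G 0) {0..pi}"
  proof (rule fundamental_theorem_of_calculus)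
    fix t :: real
    have ct: "(cos has_vector_derivative - sin t) (at t)"
      using DERIV_cos[of t] by (simp add: has_real_derivative_iff_has_vector_derivative)
    have 1: "((\<lambda>t. f (cos t)) has_vector_derivative - sin t *\<^sub>R f' (cos t)) (at t)"
      using vector_diff_chain_at[OF ct d1] by (auto simp: o_def)
    have 2: "((\<lambda>t. f' (cos t)) has_vector_derivative - sin t *\<^sub>R f'' (cos t)) (at t)"
      using vector_diff_chain_at[OF ct d2] by (auto simp: o_def)
    have 3: "((\<lambda>t. complex_of_real (- sin t * cos (n * t))) has_vector_derivative
        of_real (- cos t * cos (n * t) + sin t * (n * sin (n * t)))) (at t)"
      by (rule has_vector_derivative_of_real) (auto intro!: derivative_eq_intros simp: algebra_simps)
    have 4: "((\<lambda>t. complex_of_real (n * sin (n * t))) has_vector_derivative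
        of_real (n * (n * cos (n * t)))) (at t)"
      by (rule has_vector_derivative_of_real) (auto intro!: derivative_eq_intros simp: algebra_simps)
    have "complex_of_real (- sin t * cos (n * t)) * (- sin t *\<^sub>R f'' (cos t))
        + of_real (- cos t * cos (n * t) + sin t * (n * sin (n * t))) * f' (cos t)
        + (of_real (n * sin (n * t)) * (- sin t *\<^sub>R f' (cos t))
        + of_real (n * (n * cos (n * t))) * f (cos t)) = G' t"
      by (simp add: G'_def scaleR_conv_of_real algebra_simps power2_eq_square)
    with has_vector_derivative_add[OF has_vector_derivative_mult[OF 3 2] has_vector_derivative_mult[OF 4 1]]
    have "(G has_vector_derivative G' t) (at t)"
      by (simp only: G_def)
    then show "(G has_vector_derivative G' t) (at t within {0..pi})"
      by (rule has_vector_derivative_at_within)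
  qed simp
  moreover have "G pi - G 0 = 0" by (simp add: G_def)
  ultimately have G': "(G' has_integral 0) {0..pi}" by simp
  let ?I = "integral {0..pi} (\<lambda>t. f (cos t) * of_real (cos (real n * t)))"
  have "((\<lambda>t. (1 + of_nat n ^ 2) * (f (cos t) * of_real (cos (real n * t))) - G' t) has_integral
        (1 + of_nat n ^ 2) * ?I - 0) {0..pi}"
    by (intro has_integral_diff has_integral_mult_right G' integrable_integral
        integrable_continuous_real continuous_intros continuous_on_cos_comp[OF cf])
  moreover have "(1 + of_nat n ^ 2) * (f (cos t) * of_real (cos (real n * t))) - G' t =
      (f (cos t) - (1 - of_real (cos t) ^ 2) * f'' (cos t) + of_real (cos t) * f' (cos t))
        * of_real (cos (real n * t))" for t
  proof -
    have "complex_of_real (sin t ^ 2) = 1 - of_real (cos t) ^ 2"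
      by (simp add: sin_squared_eq)
    show ?thesis unfolding G'_def \<open>complex_of_real (sin t ^ 2) = _\<close> by (simp add: algebra_simps)
  qed
  ultimately have "integral {0..pi} (\<lambda>t. (f (cos t) - (1 - of_real (cos t) ^ 2) * f'' (cos t)
      + of_real (cos t) * f' (cos t)) * of_real (cos (real n * t))) = (1 + of_nat n ^ 2) * ?I"
    by (simp add: integral_unique)
  then show ?thesis
    by (subst (1 2) T_coeff_cos) (auto intro!: continuous_intros cf cf' c)
qed

section \<open>Completeness and Chebyshev expansion\<close>

text \<open>Orthogonality to all cosines gives orthogonality to all polynomials in cos t. By
  Weierstrass, h is a uniform limit of such polynomials, so h is orthogonal to itself.\<close>

lemma cos_moments_zero_imp_zero:
  fixes h :: "real \<Rightarrow> real"
  assumes h: "continuous_on {-1..1} h"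
    and zero: "\<And>n::nat. integral {0..pi} (\<lambda>t. h (cos t) * cos (real n * t)) = 0"
    and x: "x \<in> {-1..1}"
  shows "h x = 0"
proof -
  have mom: "integral {0..pi} (\<lambda>t. h (cos t) * cos t ^ k * cos (real n * t)) = 0" for k n :: nat
  proof (induction k arbitrary: n)
    case 0
    then show ?case using zero by simp
  next
    case (Suc k)
    \<comment> \<open>This is |n - 1|: cosine is even, so at n = 0 both neighbouring frequencies are
      1.\<close>
    define n' where "n' = (if n = 0 then 1 else n - 1)"
    have c: "cos t * cos (real n * t) = 1/2 * cos (real (Suc n) * t) + 1/2 * cos (real n' * t)" for t
    proof (cases "n = 0")
      case False
      then have *: "real (Suc n) * t = real n * t + t" "real n' * t = real n * t - t"
        by (auto simp: n'_def of_nat_diff algebra_simps)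
      show ?thesis unfolding * by (simp add: cos_add cos_diff field_simps)
    qed (simp add: n'_def)
    have "h (cos t) * cos t ^ Suc k * cos (real n * t) =
      1/2 * (h (cos t) * cos t ^ k * cos (real (Suc n) * t)) + 1/2 * (h (cos t) * cos t ^ k * cos (real n' * t))" for t
    proof -
      have "h (cos t) * cos t ^ Suc k * cos (real n * t) = h (cos t) * cos t ^ k * (cos t * cos (real n * t))"
        by simp
      also have "\<dots> = h (cos t) * cos t ^ k * (1/2 * cos (real (Suc n) * t) + 1/2 * cos (real n' * t))"
        by (rule arg_cong[OF c])
      finally show ?thesis by (simp only: distrib_left mult.left_commute)
    qed
    moreover have "((\<lambda>t. h (cos t) * cos t ^ k * cos (real m * t)) has_integral 0) {0..pi}" for m
      unfolding has_integral_iff using Suc.IH[of m]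
      by (auto intro!: integrable_continuous_real continuous_intros continuous_on_cos_comp[OF h])
    from has_integral_add[OF has_integral_mult_right[OF this, of "1/2" "Suc n"]
        has_integral_mult_right[OF this, of "1/2" n']]
    have "((\<lambda>t. 1/2 * (h (cos t) * cos t ^ k * cos (real (Suc n) * t))
        + 1/2 * (h (cos t) * cos t ^ k * cos (real n' * t))) has_integral 0) {0..pi}" by simp
    ultimately show ?case by (simp add: integral_unique)
  qed
  have poly: "integral {0..pi} (\<lambda>t. h (cos t) * p (cos t)) = 0" if "real_polynomial_function p" for p
  proof -
    obtain a N where p: "p = (\<lambda>x. \<Sum>i\<le>N. a i * x ^ i)"
      using \<open>real_polynomial_function p\<close> by (auto simp: real_polynomial_function_iff_sum)
    have 1: "((\<lambda>t. h (cos t) * cos t ^ i) has_integral 0) {0..pi}" for i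
      unfolding has_integral_iff using mom[of i 0]
      by (auto intro!: integrable_continuous_real continuous_intros continuous_on_cos_comp[OF h])
    have "((\<lambda>t. \<Sum>i\<le>N. a i * (h (cos t) * cos t ^ i)) has_integral (\<Sum>i\<le>N. a i * 0)) {0..pi}"
      by (intro has_integral_sum has_integral_mult_right 1) auto
    then show ?thesis
      by (simp add: p sum_distrib_left mult_ac integral_unique)
  qed
  have hh: "continuous_on {0..pi} (\<lambda>t. h (cos t) * h (cos t))"
    by (intro continuous_intros continuous_on_cos_comp[OF h])
  obtain B where B: "\<And>x. x \<in> {-1..1} \<Longrightarrow> \<bar>h x\<bar> \<le> B"
    using compact_imp_bounded[OF compact_continuous_image[OF h]] by (force simp: bounded_iff)
  have B0: "B \<ge> 0" using order_trans[OF abs_ge_zero B[of 0]] by simp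
  \<comment> \<open>The integral of h p vanishes, so h^2 may be replaced by h (h - p), where the
    second factor is below e.\<close>
  have small: "integral {0..pi} (\<lambda>t. h (cos t) * h (cos t)) \<le> B * e * pi" if e: "e > 0" for e
  proof -
    obtain p where p: "real_polynomial_function p" "\<And>x. x \<in> {-1..1} \<Longrightarrow> \<bar>h x - p x\<bar> < e"
      using Stone_Weierstrass_real_polynomial_function[of "{-1..1}" h e] h e by auto
    have cp: "continuous_on {-1..1} p"
      using p(1) by (simp add: continuous_on_polymonial_function real_polynomial_function_eq)
    have "integral {0..pi} (\<lambda>t. h (cos t) * h (cos t)) =
        integral {0..pi} (\<lambda>t. h (cos t) * h (cos t)) - integral {0..pi} (\<lambda>t. h (cos t) * p (cos t))"
      by (simp add: poly p(1))
    also have "\<dots> = integral {0..pi} (\<lambda>t. h (cos t) * (h (cos t) - p (cos t)))"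
      unfolding right_diff_distrib
      by (intro integral_diff[symmetric] integrable_continuous_real continuous_intros continuous_on_cos_comp[OF h] continuous_on_cos_comp[OF cp])
    also have "\<dots> \<le> norm \<dots>" by simp
    also have "\<dots> \<le> B * e * (pi - 0)"
    proof (rule integral_bound)
      fix t :: real
      have "\<bar>h (cos t)\<bar> * \<bar>h (cos t) - p (cos t)\<bar> \<le> B * e"
        using p(2)[of "cos t"] by (intro mult_mono B B0) auto
      then show "norm (h (cos t) * (h (cos t) - p (cos t))) \<le> B * e" by (simp add: abs_mult)
    qed (auto intro!: continuous_intros continuous_on_cos_comp[OF h] continuous_on_cos_comp[OF cp])
    finally show ?thesis by simp
  qed
  have "integral {0..pi} (\<lambda>t. h (cos t) * h (cos t)) \<le> 0"
  proof (rule field_le_epsilon)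
    fix e :: real assume "e > 0"
    \<comment> \<open>The summand 1 in the denominator guards against B = 0.\<close>
    then have "integral {0..pi} (\<lambda>t. h (cos t) * h (cos t)) \<le> B * (e / (B * pi + 1)) * pi"
      using B0 by (intro small divide_pos_pos add_nonneg_pos mult_nonneg_nonneg) auto
    also have "\<dots> = e * (B * pi / (B * pi + 1))" by simp
    also have "\<dots> \<le> e * 1"
      using \<open>e > 0\<close> B0 by (intro mult_left_mono) (auto simp: divide_le_eq add_nonneg_pos)
    finally show "integral {0..pi} (\<lambda>t. h (cos t) * h (cos t)) \<le> 0 + e" by simp
  qed
  moreover have "0 \<le> integral {0..pi} (\<lambda>t. h (cos t) * h (cos t))"
    by (rule integral_nonneg) (auto intro!: integrable_continuous_real hh)
  ultimately have "integral {0..pi} (\<lambda>t. h (cos t) * h (cos t)) = 0" by simp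
  then have "\<forall>t\<in>{0..pi}. h (cos t) * h (cos t) = 0"
    using integral_eq_0_iff[OF hh] by auto
  moreover have "arccos x \<in> {0..pi}" "cos (arccos x) = x"
    using x by (auto intro: arccos_lbound arccos_ubound)
  ultimately show ?thesis by fastforce
qed

lemma T_coeff_cheb_T: "T_coeff (\<lambda>x. of_real (cheb_T n x)) m = of_bool (m = n)"
proof -
  have 1: "((\<lambda>t. complex_of_real (cos (of_int (int n) * t) * cos (of_int (int m) * t) * cos (of_int 0 * t)))
      has_integral of_real (pi / 4 * (of_bool (int n + int m + 0 = 0) + of_bool (int n + int m - 0 = 0)
        + of_bool (int n - int m + 0 = 0) + of_bool (int n - int m - 0 = 0)))) {0..pi}"
    by (intro has_integral_of_real has_integral_cos_cos_cos)
  have 2: "pi / 4 * (of_bool (int n + int m + 0 = 0) + of_bool (int n + int m - 0 = 0)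
        + of_bool (int n - int m + 0 = 0) + of_bool (int n - int m - 0 = 0))
      = pi * (of_bool (m = n) / (if m = 0 then 1 else 2))"
    by (cases "m = n"; cases "m = 0") simp_all
  have 3: "integral {0..pi} (\<lambda>t. complex_of_real (cheb_T n (cos t)) * of_real (cos (real m * t)))
      = of_real (pi * (of_bool (m = n) / (if m = 0 then 1 else 2)))"
    using integral_unique[OF 1[unfolded 2]] by (simp add: cheb_T_cos)
  have c: "continuous_on {-1..1} (\<lambda>x. complex_of_real (cheb_T n x))"
    by (intro continuous_on_of_real continuous_on_cheb_T continuous_on_id)
  show ?thesis
    unfolding T_coeff_cos[OF c] 3 by simp
qed

text \<open>Absolute summability makes the series converge uniformly to a continuous g, and termwise
  integration shows that g has the same coefficients as f. Completeness then forces f = g.\<close>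

lemma cheb_expansion:
  assumes f: "continuous_on {-1..1} f"
    and abs: "(\<lambda>n. norm (T_coeff f n)) summable_on UNIV"
    and x: "x \<in> {-1..1}"
  shows "((\<lambda>n. T_coeff f n * of_real (cheb_T n x)) has_sum f x) UNIV"
proof -
  define a where "a = T_coeff f"
  define g where "g = (\<lambda>x. \<Sum>\<^sub>\<infinity>n. a n * of_real (cheb_T n x))"
  have M: "(\<lambda>n. norm (a n)) summable_on UNIV"
    using abs by (simp add: a_def)
  have bd: "norm (a n * of_real (cheb_T n x)) \<le> norm (a n)" if "x \<in> {-1..1}" for n x
    using mult_left_mono[OF cheb_T_bound norm_ge_zero[of "a n"], of x n] that
    by (simp add: norm_mult abs_le_iff)
  have gs: "((\<lambda>n. a n * of_real (cheb_T n x)) has_sum g x) UNIV" if "x \<in> {-1..1}" for x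
    unfolding g_def
    by (rule has_sum_infsum[OF abs_summable_summable[OF Infinite_Sum.abs_summable_on_comparison_test'[OF M bd[OF that]]]])
  have ca: "continuous_on S (\<lambda>x. a n * of_real (cheb_T n (h x)))" if "continuous_on S h" for n and S :: "real set" and h
    by (intro continuous_on_mult continuous_on_const continuous_on_of_real continuous_on_cheb_T that)
  have cg: "continuous_on {-1..1} g"
    by (rule has_sum_integral_Weierstrass(2)[OF ca[OF continuous_on_id] bd M gs])
  have coeff: "T_coeff g m = a m" for m
  proof -
    let ?c = "(if m = 0 then 1 else 2) / complex_of_real pi"
    have "((\<lambda>n. integral {0..pi} (\<lambda>t. a n * of_real (cheb_T n (cos t)) * of_real (cos (real m * t))))
      has_sum integral {0..pi} (\<lambda>t. g (cos t) * of_real (cos (real m * t)))) UNIV"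
    proof (rule has_sum_integral_Weierstrass(1)[where M = "\<lambda>n. norm (a n)"])
      show "norm (a n * of_real (cheb_T n (cos t)) * of_real (cos (real m * t))) \<le> norm (a n)" for n and t :: real
        using mult_mono[OF bd[of "cos t" n] abs_cos_le_one[of "real m * t"]] by (simp add: norm_mult abs_mult)
      show "((\<lambda>n. a n * of_real (cheb_T n (cos t)) * of_real (cos (real m * t))) has_sum
        g (cos t) * of_real (cos (real m * t))) UNIV" for t
        by (intro has_sum_cmult_left gs) auto
      show "continuous_on {0..pi} (\<lambda>t. a n * of_real (cheb_T n (cos t)) * of_real (cos (real m * t)))" for n
        by (intro continuous_intros ca)
    qed (rule M)
    from has_sum_cmult_right[OF this, of ?c]
    have "((\<lambda>n. ?c * integral {0..pi} (\<lambda>t. a n * of_real (cheb_T n (cos t)) * of_real (cos (real m * t))))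
      has_sum T_coeff g m) UNIV"
      by (simp add: T_coeff_cos[OF cg])
    moreover have "?c * integral {0..pi} (\<lambda>t. a n * of_real (cheb_T n (cos t)) * of_real (cos (real m * t)))
        = a n * of_bool (m = n)" for n
      unfolding T_coeff_cheb_T[of n, symmetric] T_coeff_cmult[symmetric]
      by (subst T_coeff_cos[OF ca[OF continuous_on_id]]) simp
    ultimately have "((\<lambda>n. a n * of_bool (m = n)) has_sum T_coeff g m) UNIV" by simp
    moreover have "((\<lambda>n. a n * of_bool (m = n)) has_sum a m) UNIV"
      by (rule has_sum_finite_neutralI[of "{m}"]) auto
    ultimately show ?thesis by (rule has_sum_unique)
  qed
  define d where "d = (\<lambda>x. f x - g x)"
  have cd: "continuous_on {-1..1} d"
    unfolding d_def by (intro continuous_intros f cg)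
  have d0: "integral {0..pi} (\<lambda>t. d (cos t) * of_real (cos (real m * t))) = 0" for m :: nat
  proof -
    have "T_coeff d m = 0"
      unfolding d_def by (simp add: T_coeff_diff f cg coeff a_def)
    then show ?thesis unfolding T_coeff_cos[OF cd] by (cases "m = 0") simp_all
  qed
  have i: "(\<lambda>t. d (cos t) * of_real (cos (real m * t))) integrable_on {0..pi}" for m :: nat
    by (intro integrable_continuous_real continuous_intros continuous_on_cos_comp[OF cd])
  \<comment> \<open>Completeness is available for real functions, so real and imaginary parts are
    treated separately.\<close>
  have "Re (d x) = 0"
  proof (rule cos_moments_zero_imp_zero[OF _ _ x])
    show "integral {0..pi} (\<lambda>t. Re (d (cos t)) * cos (real n * t)) = 0" for n
      using integral_linear[OF i bounded_linear_Re, of n] d0[of n] by (simp add: o_def)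
  qed (intro continuous_intros cd)
  moreover have "Im (d x) = 0"
  proof (rule cos_moments_zero_imp_zero[OF _ _ x])
    show "integral {0..pi} (\<lambda>t. Im (d (cos t)) * cos (real n * t)) = 0" for n
      using integral_linear[OF i bounded_linear_Im, of n] d0[of n] by (simp add: o_def)
  qed (intro continuous_intros cd)
  ultimately have "f x = g x" by (simp add: d_def complex_eq_iff)
  then show ?thesis using gs[OF x] by (simp add: a_def)
qed

subsection \<open>Kernels analytic on the square\<close>

lemma summable_on_comp_inj:
  fixes f :: "'a \<Rightarrow> 'b::banach"
  assumes "f summable_on UNIV" and h: "inj h"
  shows "(\<lambda>x. f (h x)) summable_on UNIV"
  using summable_on_reindex[OF h, of f] summable_on_subset_banach[OF assms(1), of "range h"]
  by (simp add: comp_def)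

text \<open>Differentiation of a multiple power series in one variable; the other exponents form the
  parameter i. Summing over i first leaves an ordinary power series, to which
  \<open>termdiffs_strong\<close> applies. The derived family is still summed jointly over i and n,
  because a partial derivative has to be a multiple power series again.\<close>

lemma power_family_has_vector_derivative:
  fixes b :: "'a \<Rightarrow> nat \<Rightarrow> complex" and f :: "real \<Rightarrow> complex"
  assumes f: "\<And>t. \<bar>t\<bar> < r \<Longrightarrow> ((\<lambda>(i, n). b i n * of_real (t ^ n)) has_sum f t) UNIV"
    and t: "\<bar>t\<bar> < r"
  obtains d where "(f has_vector_derivative d) (at t)"
    and "((\<lambda>(i, n). of_nat (Suc n) * b i (Suc n) * of_real (t ^ n)) has_sum d) UNIV"
proof -
  \<comment> \<open>A radius strictly between |t| and r leaves room to absorb the factor n that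
    differentiation produces.\<close>
  obtain \<rho> where \<rho>: "\<bar>t\<bar> < \<rho>" "\<rho> < r" using t dense by blast
  then have \<rho>0: "\<rho> > 0" "\<bar>\<rho>\<bar> < r" by auto
  have S: "(\<lambda>(i, n). norm (b i n) * \<rho> ^ n) summable_on UNIV"
    using has_sum_imp_summable[OF f[OF \<rho>0(2)]] \<rho>0(1)
    by (subst (asm) summable_on_iff_abs_summable_on_complex)
      (simp add: case_prod_unfold norm_mult norm_power)
  define a where "a n = (\<Sum>\<^sub>\<infinity>i. b i n)" for n
  have a: "((\<lambda>i. b i n) has_sum a n) UNIV" for n
  proof -
    have "(\<lambda>i. norm (b i n) * \<rho> ^ n) summable_on UNIV"
      using summable_on_comp_inj[OF S, of "\<lambda>i. (i, n)"] by (simp add: inj_on_def)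
    from summable_on_cmult_left[OF this, of "1 / \<rho> ^ n"]
    have "(\<lambda>i. norm (b i n)) summable_on UNIV" using \<rho>0 by simp
    then show ?thesis unfolding a_def by (rule has_sum_infsum[OF abs_summable_summable])
  qed
  have slices: "((\<lambda>n. a n * of_real (s ^ n)) sums f s)" if "\<bar>s\<bar> < r" for s
  proof -
    have "((\<lambda>(n, i). b i n * of_real (s ^ n)) has_sum f s) (UNIV \<times> UNIV)"
      using f[OF that] by (subst has_sum_swap) (simp add: case_prod_unfold)
    then have "((\<lambda>n. a n * of_real (s ^ n)) has_sum f s) UNIV"
      by (rule has_sum_Sigma') (auto intro!: has_sum_cmult_left a)
    then show ?thesis by (rule has_sum_imp_sums)
  qed
  have "summable (\<lambda>n. a n * of_real \<rho> ^ n)"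
    using slices[OF \<rho>0(2)] by (simp add: sums_iff)
  then have D: "DERIV (\<lambda>z. \<Sum>n. a n * z ^ n) (of_real t) :> (\<Sum>n. diffs a n * of_real t ^ n)"
    by (rule termdiffs_strong) (use \<rho> in auto)
  have "((\<lambda>s. \<Sum>n. a n * of_real s ^ n) has_vector_derivative (\<Sum>n. diffs a n * of_real t ^ n)) (at t)"
    by (rule has_vector_derivative_real_field[OF D])
  then have deriv: "(f has_vector_derivative (\<Sum>n. diffs a n * of_real t ^ n)) (at t)"
    by (rule has_vector_derivative_transform_within_open[of _ _ _ "{-r<..<r}"])
      (use t slices in \<open>auto simp: sums_iff abs_less_iff\<close>)
  \<comment> \<open>As x < 1, the sequence n x^n is bounded; this dominates the derived family at t
    by the given family at \<rho>.\<close>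
  define x where "x = \<bar>t\<bar> / \<rho>"
  have x: "0 \<le> x" "x < 1" using \<rho> \<rho>0 by (auto simp: x_def)
  obtain C where C: "\<And>n. norm (of_nat n * x ^ n) \<le> C"
    using convergent_imp_Bseq[OF convergentI[OF powser_times_n_limit_0[of x]]] x
    by (auto simp: Bseq_def)
  have bd: "norm (of_nat (Suc n) * b i (Suc n) * of_real (t ^ n)) \<le> (C + 1) / \<rho> * (norm (b i (Suc n)) * \<rho> ^ Suc n)" for i n
  proof -
    have "real (Suc n) * x ^ n \<le> C + 1"
      using C[of n] x power_le_one[of x n] by (simp add: algebra_simps)
    then have "real (Suc n) * \<bar>t\<bar> ^ n \<le> (C + 1) * \<rho> ^ n"
      using \<rho>0 by (simp add: x_def power_divide field_simps)
    then have "norm (b i (Suc n)) * (real (Suc n) * \<bar>t\<bar> ^ n) \<le> norm (b i (Suc n)) * ((C + 1) * \<rho> ^ n)"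
      by (intro mult_left_mono) auto
    moreover have "norm (of_nat (Suc n) * b i (Suc n) * of_real (t ^ n)) = norm (b i (Suc n)) * (real (Suc n) * \<bar>t\<bar> ^ n)"
      unfolding norm_mult norm_of_nat norm_of_real power_abs by (simp only: mult_ac)
    ultimately show ?thesis using \<rho>0 by (simp add: mult_ac)
  qed
  have "(\<lambda>(i, n). norm (b i (Suc n)) * \<rho> ^ Suc n) summable_on UNIV"
    using summable_on_comp_inj[OF S, of "\<lambda>(i, n). (i, Suc n)"]
    by (simp add: inj_on_def case_prod_unfold)
  from summable_on_cmult_right[OF this, of "(C + 1) / \<rho>"]
  have "(\<lambda>x. norm ((\<lambda>(i, n). of_nat (Suc n) * b i (Suc n) * of_real (t ^ n)) x)) summable_on UNIV"
    by (rule Infinite_Sum.abs_summable_on_comparison_test') (use bd in \<open>auto simp del: power_Suc of_nat_Suc\<close>)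
  then have "(\<lambda>(i, n). of_nat (Suc n) * b i (Suc n) * of_real (t ^ n)) summable_on UNIV"
    by (rule abs_summable_summable)
  then obtain d where d: "((\<lambda>(i, n). of_nat (Suc n) * b i (Suc n) * of_real (t ^ n)) has_sum d) UNIV"
    by (auto simp: summable_on_def)
  then have "((\<lambda>(n, i). of_nat (Suc n) * b i (Suc n) * of_real (t ^ n)) has_sum d) (UNIV \<times> UNIV)"
    by (subst has_sum_swap) (simp add: case_prod_unfold)
  then have "((\<lambda>n. of_nat (Suc n) * a (Suc n) * of_real (t ^ n)) has_sum d) UNIV"
    by (rule has_sum_Sigma') (auto intro!: has_sum_cmult_left has_sum_cmult_right a simp del: of_nat_Suc)
  then have "(\<Sum>n. diffs a n * of_real t ^ n) = d"
    by (auto dest!: has_sum_imp_sums simp: diffs_def sums_iff)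
  with deriv d that show ?thesis by simp
qed

text \<open>The expansion holds in a full neighbourhood of every point, also beyond the edges of the
  square, so derivatives there are two-sided. As \<open>has_sum\<close> is unconditional, the double
  series may be rearranged freely.\<close>

definition analytic_sq :: "(real \<Rightarrow> real \<Rightarrow> complex) \<Rightarrow> bool" where
  "analytic_sq K \<longleftrightarrow> (\<forall>x\<in>{-1..1}. \<forall>y\<in>{-1..1}. \<exists>r>0. \<exists>c. \<forall>h k. \<bar>h\<bar> < r \<longrightarrow> \<bar>k\<bar> < r \<longrightarrow>
     ((\<lambda>(i, j). c i j * of_real (h ^ i * k ^ j)) has_sum K (x + h) (y + k)) UNIV)"

lemma analytic_sqE:
  assumes "analytic_sq K" "x \<in> {-1..1}" "y \<in> {-1..1}"
  obtains r c where "r > 0"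
    "\<And>h k. \<bar>h\<bar> < r \<Longrightarrow> \<bar>k\<bar> < r \<Longrightarrow>
      ((\<lambda>(i, j). c i j * of_real (h ^ i * k ^ j)) has_sum K (x + h) (y + k)) UNIV"
  using assms unfolding analytic_sq_def by meson

lemma analytic_sqI:
  assumes "\<And>x y. x \<in> {-1..1} \<Longrightarrow> y \<in> {-1..1} \<Longrightarrow> \<exists>r>0. \<exists>c. \<forall>h k. \<bar>h\<bar> < r \<longrightarrow> \<bar>k\<bar> < r \<longrightarrow>
     ((\<lambda>(i, j). c i j * of_real (h ^ i * k ^ j)) has_sum K (x + h) (y + k)) UNIV"
  shows "analytic_sq K"
  using assms unfolding analytic_sq_def by blast

lemma analytic_sq_transpose: "analytic_sq K \<Longrightarrow> analytic_sq (\<lambda>x y. K y x)"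
proof (rule analytic_sqI)
  fix x y :: real assume K: "analytic_sq K" and "x \<in> {-1..1}" "y \<in> {-1..1}"
  from analytic_sqE[OF K this(3,2)] obtain r c where r: "r > 0" and
    c: "\<And>h k. \<bar>h\<bar> < r \<Longrightarrow> \<bar>k\<bar> < r \<Longrightarrow>
      ((\<lambda>(i, j). c i j * of_real (h ^ i * k ^ j)) has_sum K (y + h) (x + k)) UNIV" by blast
  have "((\<lambda>(i, j). c j i * of_real (h ^ i * k ^ j)) has_sum K (y + k) (x + h)) UNIV"
    if "\<bar>h\<bar> < r" "\<bar>k\<bar> < r" for h k
    using c[OF that(2,1)] has_sum_swap[of "\<lambda>(i, j). c j i * of_real (h ^ i * k ^ j)" UNIV UNIV "K (y + k) (x + h)"]
    by (simp add: case_prod_unfold mult.commute)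
  then show "\<exists>r>0. \<exists>c. \<forall>h k. \<bar>h\<bar> < r \<longrightarrow> \<bar>k\<bar> < r \<longrightarrow>
     ((\<lambda>(i, j). c i j * of_real (h ^ i * k ^ j)) has_sum K (y + k) (x + h)) UNIV"
    using r by (intro exI[of _ r] conjI exI[of _ "\<lambda>i j. c j i"]) auto
qed

lemma analytic_sq_add:
  assumes "analytic_sq K" "analytic_sq L"
  shows "analytic_sq (\<lambda>x y. K x y + L x y)"
proof (rule analytic_sqI)
  fix x y :: real assume xy: "x \<in> {-1..1}" "y \<in> {-1..1}"
  from analytic_sqE[OF assms(1) xy] obtain r c where r: "r > 0" and
    c: "\<And>h k. \<bar>h\<bar> < r \<Longrightarrow> \<bar>k\<bar> < r \<Longrightarrow>
      ((\<lambda>(i, j). c i j * of_real (h ^ i * k ^ j)) has_sum K (x + h) (y + k)) UNIV" by blast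
  from analytic_sqE[OF assms(2) xy] obtain r' c' where r': "r' > 0" and
    c': "\<And>h k. \<bar>h\<bar> < r' \<Longrightarrow> \<bar>k\<bar> < r' \<Longrightarrow>
      ((\<lambda>(i, j). c' i j * of_real (h ^ i * k ^ j)) has_sum L (x + h) (y + k)) UNIV" by blast
  have "((\<lambda>(i, j). (c i j + c' i j) * of_real (h ^ i * k ^ j)) has_sum K (x + h) (y + k) + L (x + h) (y + k)) UNIV"
    if "\<bar>h\<bar> < min r r'" "\<bar>k\<bar> < min r r'" for h k
    using has_sum_add[OF c c', of h k] that by (simp add: case_prod_unfold distrib_right)
  then show "\<exists>r>0. \<exists>c. \<forall>h k. \<bar>h\<bar> < r \<longrightarrow> \<bar>k\<bar> < r \<longrightarrow>
     ((\<lambda>(i, j). c i j * of_real (h ^ i * k ^ j)) has_sum K (x + h) (y + k) + L (x + h) (y + k)) UNIV"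
    using r r' by (intro exI[of _ "min r r'"] conjI exI[of _ "\<lambda>i j. c i j + c' i j"]) auto
qed

lemma analytic_sq_cmult: "analytic_sq K \<Longrightarrow> analytic_sq (\<lambda>x y. a * K x y)"
proof (rule analytic_sqI)
  fix x y :: real assume K: "analytic_sq K" and "x \<in> {-1..1}" "y \<in> {-1..1}"
  from analytic_sqE[OF this] obtain r c where r: "r > 0" and
    c: "\<And>h k. \<bar>h\<bar> < r \<Longrightarrow> \<bar>k\<bar> < r \<Longrightarrow>
      ((\<lambda>(i, j). c i j * of_real (h ^ i * k ^ j)) has_sum K (x + h) (y + k)) UNIV" by blast
  have "((\<lambda>(i, j). (a * c i j) * of_real (h ^ i * k ^ j)) has_sum a * K (x + h) (y + k)) UNIV"
    if "\<bar>h\<bar> < r" "\<bar>k\<bar> < r" for h k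
    using has_sum_cmult_right[OF c[OF that], of a] by (simp add: case_prod_unfold mult_ac)
  then show "\<exists>r>0. \<exists>c. \<forall>h k. \<bar>h\<bar> < r \<longrightarrow> \<bar>k\<bar> < r \<longrightarrow>
     ((\<lambda>(i, j). c i j * of_real (h ^ i * k ^ j)) has_sum a * K (x + h) (y + k)) UNIV"
    using r by (intro exI[of _ r] conjI exI[of _ "\<lambda>i j. a * c i j"]) auto
qed

lemma analytic_sq_times_fst: "analytic_sq K \<Longrightarrow> analytic_sq (\<lambda>x y. of_real x * K x y)"
proof (rule analytic_sqI)
  fix x y :: real assume K: "analytic_sq K" and "x \<in> {-1..1}" "y \<in> {-1..1}"
  from analytic_sqE[OF this] obtain r c where r: "r > 0" and
    c: "\<And>h k. \<bar>h\<bar> < r \<Longrightarrow> \<bar>k\<bar> < r \<Longrightarrow>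
      ((\<lambda>(i, j). c i j * of_real (h ^ i * k ^ j)) has_sum K (x + h) (y + k)) UNIV" by blast
  \<comment> \<open>Around the base point the factor is x + h: the constant x scales the
    coefficients, and h shifts the first exponent by one.\<close>
  define c' where "c' = (\<lambda>i j. of_real x * c i j + (case i of 0 \<Rightarrow> 0 | Suc i \<Rightarrow> c i j))"
  have "((\<lambda>(i, j). c' i j * of_real (h ^ i * k ^ j)) has_sum of_real (x + h) * K (x + h) (y + k)) UNIV"
    if hk: "\<bar>h\<bar> < r" "\<bar>k\<bar> < r" for h k
  proof -
    let ?g = "\<lambda>(i, j). (case i of 0 \<Rightarrow> 0 | Suc i \<Rightarrow> c i j) * complex_of_real (h ^ i * k ^ j)"
    let ?s = "\<lambda>(i, j). (Suc i, j :: nat)"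
    have "((\<lambda>(i, j). of_real h * (c i j * of_real (h ^ i * k ^ j))) has_sum of_real h * K (x + h) (y + k)) UNIV"
      using has_sum_cmult_right[OF c[OF hk], of "of_real h"] by (simp add: case_prod_unfold)
    moreover have "(\<lambda>(i, j). of_real h * (c i j * of_real (h ^ i * k ^ j))) = ?g \<circ> ?s"
      by (auto simp: o_def fun_eq_iff mult_ac)
    moreover have "inj ?s" by (auto simp: inj_on_def)
    ultimately have "(?g has_sum of_real h * K (x + h) (y + k)) (range ?s)"
      by (subst has_sum_reindex) auto
    moreover have "(a, b) \<in> range ?s \<longleftrightarrow> a \<noteq> 0" for a b
      by (cases a) (auto simp: image_iff)
    ultimately have "(?g has_sum of_real h * K (x + h) (y + k)) UNIV"
      by (subst has_sum_cong_neutral[where T = "range ?s" and g = ?g]) (auto split: nat.splits)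
    from has_sum_add[OF has_sum_cmult_right[OF c[OF hk], of "of_real x"] this]
    show ?thesis by (simp add: c'_def case_prod_unfold distrib_right mult.assoc)
  qed
  then show "\<exists>r>0. \<exists>c. \<forall>h k. \<bar>h\<bar> < r \<longrightarrow> \<bar>k\<bar> < r \<longrightarrow>
     ((\<lambda>(i, j). c i j * of_real (h ^ i * k ^ j)) has_sum of_real (x + h) * K (x + h) (y + k)) UNIV"
    using r by (intro exI[of _ r] conjI exI[of _ c']) auto
qed

lemma analytic_sq_deriv:
  assumes K: "analytic_sq K"
  obtains K' where "analytic_sq K'"
    and "\<And>x y. x \<in> {-1..1} \<Longrightarrow> y \<in> {-1..1} \<Longrightarrow> ((\<lambda>s. K s y) has_vector_derivative K' x y) (at x)"
proof -
  \<comment> \<open>A global definition by \<open>vector_derivative\<close> makes the local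
    expansions around different base points describe the same function.\<close>
  define K' where "K' = (\<lambda>x y. vector_derivative (\<lambda>s. K s y) (at x))"
  \<comment> \<open>The derivative is computed at all points near (x, y), some outside the square,
    since the power series of K' has to represent it on a whole neighbourhood.\<close>
  have *: "\<exists>r>0. \<exists>c. \<forall>h k. \<bar>h\<bar> < r \<longrightarrow> \<bar>k\<bar> < r \<longrightarrow>
      ((\<lambda>s. K s (y + k)) has_vector_derivative K' (x + h) (y + k)) (at (x + h)) \<and>
     ((\<lambda>(i, j). c i j * of_real (h ^ i * k ^ j)) has_sum K' (x + h) (y + k)) UNIV"
    if xy: "x \<in> {-1..1}" "y \<in> {-1..1}" for x y
  proof -
    from analytic_sqE[OF K xy] obtain r c where r: "r > 0" and
      c: "\<And>h k. \<bar>h\<bar> < r \<Longrightarrow> \<bar>k\<bar> < r \<Longrightarrow>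
        ((\<lambda>(i, j). c i j * of_real (h ^ i * k ^ j)) has_sum K (x + h) (y + k)) UNIV" by blast
    have "((\<lambda>s. K s (y + k)) has_vector_derivative K' (x + h) (y + k)) (at (x + h)) \<and>
     ((\<lambda>(i, j). (of_nat (Suc i) * c (Suc i) j) * of_real (h ^ i * k ^ j)) has_sum K' (x + h) (y + k)) UNIV"
      if hk: "\<bar>h\<bar> < r" "\<bar>k\<bar> < r" for h k
    proof -
      have fam: "((\<lambda>(j, i). (c i j * of_real (k ^ j)) * of_real (s ^ i)) has_sum K (x + s) (y + k)) UNIV"
        if "\<bar>s\<bar> < r" for s
        using c[OF that hk(2)]
          has_sum_swap[of "\<lambda>(j, i). (c i j * of_real (k ^ j)) * of_real (s ^ i)" UNIV UNIV "K (x + s) (y + k)"]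
        by (simp add: case_prod_unfold mult_ac)
      obtain d where d: "((\<lambda>s. K (x + s) (y + k)) has_vector_derivative d) (at h)"
        and dsum: "((\<lambda>(j, i). of_nat (Suc i) * (c (Suc i) j * of_real (k ^ j)) * of_real (h ^ i)) has_sum d) UNIV"
        by (rule power_family_has_vector_derivative[OF fam hk(1)])
      have "((\<lambda>s. s - x) has_vector_derivative 1) (at (x + h))"
        by (auto intro!: derivative_eq_intros)
      from vector_diff_chain_at[OF this, of "\<lambda>s. K (x + s) (y + k)" d] d
      have D: "((\<lambda>s. K s (y + k)) has_vector_derivative d) (at (x + h))" by (simp add: o_def)
      then have "K' (x + h) (y + k) = d" by (simp add: K'_def vector_derivative_at)
      with D dsum has_sum_swap[of "\<lambda>(j, i). of_nat (Suc i) * (c (Suc i) j * of_real (k ^ j)) * of_real (h ^ i)" UNIV UNIV d]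
      show ?thesis by (simp add: case_prod_unfold mult_ac)
    qed
    with r show ?thesis
      by (intro exI[of _ r] conjI exI[of _ "\<lambda>i j. of_nat (Suc i) * c (Suc i) j"]) blast+
  qed
  show ?thesis
  proof (rule that)
    show "analytic_sq K'"
    proof (rule analytic_sqI)
      fix x y :: real assume "x \<in> {-1..1}" "y \<in> {-1..1}"
      from *[OF this] show "\<exists>r>0. \<exists>c. \<forall>h k. \<bar>h\<bar> < r \<longrightarrow> \<bar>k\<bar> < r \<longrightarrow>
        ((\<lambda>(i, j). c i j * of_real (h ^ i * k ^ j)) has_sum K' (x + h) (y + k)) UNIV" by meson
    qed
    fix x y :: real assume "x \<in> {-1..1}" "y \<in> {-1..1}"
    from *[OF this] show "((\<lambda>s. K s y) has_vector_derivative K' x y) (at x)"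
      by (metis abs_zero add.right_neutral)
  qed
qed

lemma analytic_sq_continuous:
  assumes K: "analytic_sq K"
  shows "continuous_on ({-1..1} \<times> {-1..1}) (\<lambda>(x, y). K x y)"
proof (rule continuous_at_imp_continuous_on, safe)
  fix x y :: real assume xy: "x \<in> {-1..1}" "y \<in> {-1..1}"
  from analytic_sqE[OF K xy] obtain r c where r: "r > 0" and
    c: "\<And>h k. \<bar>h\<bar> < r \<Longrightarrow> \<bar>k\<bar> < r \<Longrightarrow>
      ((\<lambda>(i, j). c i j * of_real (h ^ i * k ^ j)) has_sum K (x + h) (y + k)) UNIV" by blast
  define \<rho> where "\<rho> = r / 2"
  have \<rho>: "\<rho> > 0" "\<bar>\<rho>\<bar> < r" using r by (auto simp: \<rho>_def)
  let ?B = "{-\<rho><..<\<rho>} \<times> {-\<rho><..<\<rho>}"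
  let ?t = "\<lambda>ij z. c (fst ij) (snd ij) * of_real (fst z ^ fst ij * snd z ^ snd ij)"
  have lim: "uniform_limit ?B (\<lambda>X z. \<Sum>ij\<in>X. ?t ij z) (\<lambda>z. K (x + fst z) (y + snd z)) (finite_subsets_at_top UNIV)"
  proof (rule Weierstrass_m_test_general'[where M = "\<lambda>ij. norm (c (fst ij) (snd ij)) * (\<rho> ^ fst ij * \<rho> ^ snd ij)"])
    show "(\<lambda>ij. norm (c (fst ij) (snd ij)) * (\<rho> ^ fst ij * \<rho> ^ snd ij)) summable_on UNIV"
      using has_sum_imp_summable[OF c[OF \<rho>(2) \<rho>(2)]] \<rho>
      by (subst (asm) summable_on_iff_abs_summable_on_complex)
        (simp add: case_prod_unfold norm_mult norm_power)
    fix z assume z: "z \<in> ?B"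
    show "((\<lambda>ij. ?t ij z) has_sum K (x + fst z) (y + snd z)) UNIV"
      using c[of "fst z" "snd z"] z \<rho> by (auto simp: case_prod_unfold)
    fix ij :: "nat \<times> nat"
    show "norm (?t ij z) \<le> norm (c (fst ij) (snd ij)) * (\<rho> ^ fst ij * \<rho> ^ snd ij)"
      unfolding norm_mult norm_of_real abs_mult power_abs
      using z by (intro mult_left_mono mult_mono power_mono) auto
  qed
  have "continuous_on ?B (\<lambda>z. K (x + fst z) (y + snd z))"
    by (rule uniform_limit_theorem[OF _ lim]) (auto intro!: always_eventually continuous_intros)
  then have "isCont (\<lambda>z. K (x + fst z) (y + snd z)) (0, 0)"
    using \<rho> by (subst (asm) continuous_on_eq_continuous_at) (auto intro!: open_Times)
  then have "isCont (\<lambda>w. K (x + (fst w - x)) (y + (snd w - y))) (x, y)"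
    using isCont_o2[of "(x, y)" "\<lambda>w. (fst w - x, snd w - y)" "\<lambda>z. K (x + fst z) (y + snd z)"]
    by (simp add: continuous_intros)
  then show "isCont (\<lambda>(x, y). K x y) (x, y)" by (simp add: case_prod_unfold)
qed

section \<open>Restriction of the kernels to the line\<close>

text \<open>With both transversal increments 0, the terms with j = n = 0 are the only ones left,
  where 0 ^ 0 = 1.\<close>

lemma analytic_sq_on_line:
  assumes W: "{-1..1} \<times> {0} \<subseteq> W" and F: "analytic_pair_on F W"
  shows "analytic_sq (on_line F)"
proof (rule analytic_sqI)
  fix x y :: real assume "x \<in> {-1..1}" "y \<in> {-1..1}"
  with W have "(x, 0) \<in> W" "(y, 0) \<in> W" by auto
  with F obtain r c where r: "r > 0" and c: "\<And>h1 h2 k1 k2. \<bar>h1\<bar> < r \<Longrightarrow> \<bar>h2\<bar> < r \<Longrightarrow> \<bar>k1\<bar> < r \<Longrightarrow> \<bar>k2\<bar> < r \<Longrightarrow>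
           ((\<lambda>(i, j, m, n). c (i, j, m, n) * of_real (h1 ^ i * h2 ^ j * k1 ^ m * k2 ^ n))
              has_sum F (x + h1, 0 + h2) (y + k1, 0 + k2)) UNIV"
    unfolding analytic_pair_on_def by meson
  have "((\<lambda>(i, m). c (i, 0, m, 0) * of_real (h ^ i * k ^ m)) has_sum on_line F (x + h) (y + k)) UNIV"
    if "\<bar>h\<bar> < r" "\<bar>k\<bar> < r" for h k
  proof -
    let ?g = "\<lambda>(i, j, m, n). c (i, j, m, n) * of_real (h ^ i * 0 ^ j * k ^ m * 0 ^ n)"
    let ?s = "\<lambda>(i, m). (i, 0::nat, m, 0::nat)"
    have "(?g has_sum on_line F (x + h) (y + k)) UNIV"
      using c[of h 0 k 0] r that by (simp add: on_line_def)
    then have "(?g has_sum on_line F (x + h) (y + k)) (range ?s)"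
      by (subst has_sum_cong_neutral[where T = UNIV and g = ?g]) (auto simp: image_iff)
    then have "((?g \<circ> ?s) has_sum on_line F (x + h) (y + k)) UNIV"
      by (subst (asm) has_sum_reindex) (auto simp: inj_on_def)
    then show ?thesis by (simp add: o_def case_prod_unfold)
  qed
  then show "\<exists>r>0. \<exists>c. \<forall>h k. \<bar>h\<bar> < r \<longrightarrow> \<bar>k\<bar> < r \<longrightarrow>
     ((\<lambda>(i, j). c i j * of_real (h ^ i * k ^ j)) has_sum on_line F (x + h) (y + k)) UNIV"
    using r by (intro exI[of _ r] conjI exI[of _ "\<lambda>i m. c (i, 0, m, 0)"]) auto
qed

text \<open>At t = 0 the derived series reduces to its constant terms, so the derivative reads off
  the coefficients of exponent one.\<close>

lemma power_family_deriv_0: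
  fixes b :: "'a \<Rightarrow> nat \<Rightarrow> complex" and f :: "real \<Rightarrow> complex"
  assumes f: "\<And>t. \<bar>t\<bar> < r \<Longrightarrow> ((\<lambda>(i, n). b i n * of_real (t ^ n)) has_sum f t) UNIV"
    and r: "r > 0"
  shows "((\<lambda>i. b i 1) has_sum vector_derivative f (at 0)) UNIV"
proof -
  obtain d where d: "(f has_vector_derivative d) (at 0)"
    and s: "((\<lambda>(i, n). of_nat (Suc n) * b i (Suc n) * of_real (0 ^ n)) has_sum d) UNIV"
    using power_family_has_vector_derivative[OF f, of r 0] r by auto
  let ?g = "\<lambda>(i, n). of_nat (Suc n) * b i (Suc n) * of_real (0 ^ n)"
  let ?s = "\<lambda>i::'a. (i, 0::nat)"
  have "(?g has_sum d) (range ?s)"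
    using s by (subst has_sum_cong_neutral[where T = UNIV and g = ?g]) (auto simp: image_iff)
  then have "((?g \<circ> ?s) has_sum d) UNIV"
    by (subst (asm) has_sum_reindex) (auto simp: inj_on_def)
  then show ?thesis using vector_derivative_at[OF d] by (simp add: o_def)
qed

text \<open>The mixed transversal derivative selects j = n = 1 from the series in four variables:
  the linear coefficient is read off first in t, then in s.\<close>

lemma analytic_sq_d2_on_line:
  assumes W: "{-1..1} \<times> {0} \<subseteq> W" and F: "analytic_pair_on F W"
  shows "analytic_sq (d2_on_line F)"
proof (rule analytic_sqI)
  fix x y :: real assume "x \<in> {-1..1}" "y \<in> {-1..1}"
  with W have "(x, 0) \<in> W" "(y, 0) \<in> W" by auto
  with F obtain r c where r: "r > 0" and c: "\<And>h1 h2 k1 k2. \<bar>h1\<bar> < r \<Longrightarrow> \<bar>h2\<bar> < r \<Longrightarrow> \<bar>k1\<bar> < r \<Longrightarrow> \<bar>k2\<bar> < r \<Longrightarrow>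
           ((\<lambda>(i, j, m, n). c (i, j, m, n) * of_real (h1 ^ i * h2 ^ j * k1 ^ m * k2 ^ n))
              has_sum F (x + h1, 0 + h2) (y + k1, 0 + k2)) UNIV"
    unfolding analytic_pair_on_def by meson
  have "((\<lambda>(i, m). c (i, 1, m, 1) * of_real (h ^ i * k ^ m)) has_sum d2_on_line F (x + h) (y + k)) UNIV"
    if hk: "\<bar>h\<bar> < r" "\<bar>k\<bar> < r" for h k
  proof -
    define g where "g = (\<lambda>s. vector_derivative (\<lambda>t. F (x + h, s) (y + k, t)) (at 0))"
    have g: "((\<lambda>((i, m), j). (c (i, j, m, 1) * of_real (h ^ i * k ^ m)) * of_real (s ^ j)) has_sum g s) UNIV"
      if s: "\<bar>s\<bar> < r" for s
    proof -
      \<comment> \<open>The exponents are regrouped so that the one of t stands last and the other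
        three act as the parameter of the family.\<close>
      have "((\<lambda>(((i, m), j), n). (c (i, j, m, n) * of_real (h ^ i * k ^ m) * of_real (s ^ j)) * of_real (t ^ n))
          has_sum F (x + h, s) (y + k, t)) UNIV" if t: "\<bar>t\<bar> < r" for t
        using c[OF hk(1) s hk(2) t]
        by (subst has_sum_reindex_bij_witness[of UNIV "\<lambda>(i, j, m, n). (((i, m), j), n)" "\<lambda>(((i, m), j), n). (i, j, m, n)" UNIV
              "\<lambda>(i, j, m, n). c (i, j, m, n) * of_real (h ^ i * s ^ j * k ^ m * t ^ n)" _ "F (x + h, s) (y + k, t)"])
          (auto simp: mult_ac)
      then have "((\<lambda>((i, m), j). (c (i, j, m, 1) * of_real (h ^ i * k ^ m) * of_real (s ^ j))) has_sum g s) UNIV"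
        unfolding g_def
        using power_family_deriv_0[of r "\<lambda>((i, m), j) n. c (i, j, m, n) * of_real (h ^ i * k ^ m) * of_real (s ^ j)"
            "\<lambda>t. F (x + h, s) (y + k, t)"] r by (simp add: case_prod_unfold)
      then show ?thesis by (simp add: mult.assoc)
    qed
    have "((\<lambda>(i, m). c (i, 1, m, 1) * of_real (h ^ i * k ^ m)) has_sum vector_derivative g (at 0)) UNIV"
      using power_family_deriv_0[of r "\<lambda>(i, m) j. c (i, j, m, 1) * of_real (h ^ i * k ^ m)" g] g r
      by (simp add: case_prod_unfold)
    then show ?thesis by (simp add: d2_on_line_def g_def)
  qed
  then show "\<exists>r>0. \<exists>c. \<forall>h k. \<bar>h\<bar> < r \<longrightarrow> \<bar>k\<bar> < r \<longrightarrow>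
     ((\<lambda>(i, j). c i j * of_real (h ^ i * k ^ j)) has_sum d2_on_line F (x + h) (y + k)) UNIV"
    using r by (intro exI[of _ r] conjI exI[of _ "\<lambda>i m. c (i, 1, m, 1)"]) auto
qed

section \<open>Bivariate Chebyshev coefficients and their decay\<close>

abbreviation "unit_sq \<equiv> {-1..1::real} \<times> {-1..1::real}"

lemma continuous_on_slice:
  assumes "continuous_on unit_sq (\<lambda>(x, y). K x y)" "x \<in> {-1..1}"
  shows "continuous_on {-1..1} (K x)"
  by (rule continuous_on_compose2[OF assms(1), of _ "\<lambda>y. (x, y)", simplified])
    (use assms(2) in \<open>auto intro!: continuous_intros\<close>)

lemma continuous_on_cos_cos:
  assumes "continuous_on unit_sq (\<lambda>(x, y). K x y)"
  shows "continuous_on S (\<lambda>z. K (cos (fst z)) (cos (snd z)))"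
  by (rule continuous_on_compose2[OF assms, of _ "\<lambda>z. (cos (fst z), cos (snd z))", simplified])
    (auto intro!: continuous_intros)

lemma continuous_on_T_coeff:
  assumes K: "continuous_on unit_sq (\<lambda>(x, y). K x y)"
  shows "continuous_on {-1..1} (\<lambda>x. T_coeff (K x) q)"
proof -
  have "continuous_on {-1..1} (\<lambda>x. integral (cbox 0 pi) (\<lambda>t. K x (cos t) * of_real (cos (real q * t))))"
  proof (rule integral_continuous_on_param)
    have "continuous_on ({-1..1} \<times> cbox 0 pi) (\<lambda>z. K (fst z) (cos (snd z)))"
      by (rule continuous_on_compose2[OF K, of _ "\<lambda>z. (fst z, cos (snd z))", simplified])
        (auto intro!: continuous_intros)
    then show "continuous_on ({-1..1} \<times> cbox 0 pi) (\<lambda>(x, t). K x (cos t) * of_real (cos (real q * t)))"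
      unfolding case_prod_unfold by (intro continuous_intros)
  qed
  then have "continuous_on {-1..1} (\<lambda>x. (if q = 0 then 1 else 2) / of_real pi *
     integral {0..pi} (\<lambda>t. K x (cos t) * of_real (cos (real q * t))))"
    by (intro continuous_intros) simp
  then show ?thesis
    by (rule continuous_on_eq) (simp add: T_coeff_cos continuous_on_slice[OF K])
qed

lemma cheb2_coeff_double_integral:
  assumes K: "continuous_on unit_sq (\<lambda>(x, y). K x y)"
  shows "cheb2_coeff K p q = (if p = 0 then 1 else 2) / of_real pi * ((if q = 0 then 1 else 2) / of_real pi *
    integral {0..pi} (\<lambda>t. integral {0..pi} (\<lambda>s. K (cos t) (cos s) * of_real (cos (real p * t) * cos (real q * s)))))"
proof -
  let ?cp = "(if p = 0 then 1 else 2) / complex_of_real pi"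
  let ?cq = "(if q = 0 then 1 else 2) / complex_of_real pi"
  have "cheb2_coeff K p q = ?cp * integral {0..pi} (\<lambda>t. T_coeff (K (cos t)) q * of_real (cos (real p * t)))"
    unfolding cheb2_coeff_def by (subst T_coeff_cos[OF continuous_on_T_coeff[OF K]]) simp
  also have "(\<lambda>t. T_coeff (K (cos t)) q * of_real (cos (real p * t))) =
    (\<lambda>t. ?cq * integral {0..pi} (\<lambda>s. K (cos t) (cos s) * of_real (cos (real p * t) * cos (real q * s))))"
  proof
    fix t
    have "integral {0..pi} (\<lambda>s. K (cos t) (cos s) * of_real (cos (real q * s))) * of_real (cos (real p * t))
      = integral {0..pi} (\<lambda>s. K (cos t) (cos s) * of_real (cos (real q * s)) * of_real (cos (real p * t)))"
      by (rule integral_mult_left[symmetric])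
    also have "(\<lambda>s. K (cos t) (cos s) * of_real (cos (real q * s)) * of_real (cos (real p * t)))
      = (\<lambda>s. K (cos t) (cos s) * of_real (cos (real p * t) * cos (real q * s)))"
      by (simp add: mult_ac)
    finally show "T_coeff (K (cos t)) q * of_real (cos (real p * t)) =
      ?cq * integral {0..pi} (\<lambda>s. K (cos t) (cos s) * of_real (cos (real p * t) * cos (real q * s)))"
      by (subst T_coeff_cos[OF continuous_on_slice[OF K]]) (simp_all only: mult.assoc cos_le_one cos_ge_minus_one atLeastAtMost_iff simp_thms)
  qed
  finally show ?thesis by (simp only: integral_mult_right)
qed

text \<open>Fubini in the angular variables. It carries statements about the inner variable over to
  the outer one.\<close>

lemma cheb2_coeff_transpose:
  assumes K: "continuous_on unit_sq (\<lambda>(x, y). K x y)"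
  shows "cheb2_coeff K p q = cheb2_coeff (\<lambda>x y. K y x) q p"
proof -
  have K': "continuous_on unit_sq (\<lambda>(x, y). K y x)"
    using swap_continuous[of "-1" "-1" 1 1 K] K by (simp add: cbox_Pair_eq)
  have "continuous_on (cbox (0, 0) (pi, pi)) (\<lambda>(t, s). K (cos t) (cos s) * of_real (cos (real p * t) * cos (real q * s)))"
    unfolding case_prod_unfold by (intro continuous_intros continuous_on_cos_cos[OF K])
  from integral_swap_continuous[OF this] show ?thesis
    by (simp add: cheb2_coeff_double_integral[OF K] cheb2_coeff_double_integral[OF K'] mult_ac)
qed

lemma norm_cheb2_coeff_le:
  assumes K: "continuous_on unit_sq (\<lambda>(x, y). K x y)"
  obtains B where "\<And>p q. norm (cheb2_coeff K p q) \<le> B"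
proof -
  obtain B where B: "\<And>x y. x \<in> {-1..1} \<Longrightarrow> y \<in> {-1..1} \<Longrightarrow> norm (K x y) \<le> B"
    using compact_imp_bounded[OF compact_continuous_image[OF K]]
    by (force simp: bounded_iff compact_Times)
  have "norm (cheb2_coeff K p q) \<le> 2 * (2 * B)" for p q
    unfolding cheb2_coeff_def
    by (intro T_coeff_bound continuous_on_T_coeff K continuous_on_slice[OF K] B)
  then show ?thesis by (rule that)
qed

lemma analytic_sq_eigen_fst:
  assumes K: "analytic_sq K"
  obtains L where "analytic_sq L"
    "\<And>y n. y \<in> {-1..1} \<Longrightarrow> T_coeff (\<lambda>x. L x y) n = (1 + of_nat n ^ 2) * T_coeff (\<lambda>x. K x y) n"
proof -
  obtain K' where K': "analytic_sq K'"
    and d: "\<And>x y. x \<in> {-1..1} \<Longrightarrow> y \<in> {-1..1} \<Longrightarrow> ((\<lambda>s. K s y) has_vector_derivative K' x y) (at x)"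
    by (rule analytic_sq_deriv[OF K]) blast
  obtain K'' where K'': "analytic_sq K''"
    and d': "\<And>x y. x \<in> {-1..1} \<Longrightarrow> y \<in> {-1..1} \<Longrightarrow> ((\<lambda>s. K' s y) has_vector_derivative K'' x y) (at x)"
    by (rule analytic_sq_deriv[OF K']) blast
  \<comment> \<open>This is K - (1 - x^2) K'' + x K', spelled out with sums, scalar factors and
    multiplications by x so that the closure properties apply.\<close>
  define L where "L = (\<lambda>x y. K x y + (- 1 * K'' x y + (of_real x * (of_real x * K'' x y) + of_real x * K' x y)))"
  have "analytic_sq L"
    unfolding L_def by (intro analytic_sq_add analytic_sq_cmult analytic_sq_times_fst K K' K'')
  moreover have "T_coeff (\<lambda>x. L x y) n = (1 + of_nat n ^ 2) * T_coeff (\<lambda>x. K x y) n" if y: "y \<in> {-1..1}" for y n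
  proof -
    have "continuous_on {-1..1} (\<lambda>x. K'' x y)"
      using continuous_on_slice[OF analytic_sq_continuous[OF analytic_sq_transpose[OF K'']] y] .
    from T_coeff_eigen[OF d[OF _ y] d'[OF _ y] this, of n]
    show ?thesis by (simp add: L_def algebra_simps power2_eq_square)
  qed
  ultimately show ?thesis by (rule that)
qed

text \<open>In the inner variable the eigenvalue is a constant factor of each inner coefficient and
  passes through the outer one. Transposition gives the same for the outer variable.\<close>

lemma analytic_sq_eigen:
  assumes K: "analytic_sq K"
  obtains L where "analytic_sq L"
    "\<And>p q. cheb2_coeff L p q = (1 + of_nat p ^ 2) * (1 + of_nat q ^ 2) * cheb2_coeff K p q"
proof -
  have snd_step: "\<exists>L. analytic_sq L \<and> (\<forall>p q. cheb2_coeff L p q = (1 + of_nat q ^ 2) * cheb2_coeff K p q)"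
    if K: "analytic_sq K" for K
  proof -
    obtain L where L: "analytic_sq L"
      and c: "\<And>x n. x \<in> {-1..1} \<Longrightarrow> T_coeff (\<lambda>y. L y x) n = (1 + of_nat n ^ 2) * T_coeff (\<lambda>y. K x y) n"
      by (rule analytic_sq_eigen_fst[OF analytic_sq_transpose[OF K]]) blast
    have "cheb2_coeff (\<lambda>x y. L y x) p q = (1 + of_nat q ^ 2) * cheb2_coeff K p q" for p q
      unfolding cheb2_coeff_def T_coeff_cmult[symmetric] by (rule T_coeff_cong) (simp add: c T_coeff_cmult)
    with analytic_sq_transpose[OF L] show ?thesis by blast
  qed
  obtain L1 where L1: "analytic_sq L1" "\<And>p q. cheb2_coeff L1 p q = (1 + of_nat q ^ 2) * cheb2_coeff K p q"
    using snd_step[OF K] by blast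
  obtain L2 where L2: "analytic_sq L2"
    "\<And>p q. cheb2_coeff L2 p q = (1 + of_nat q ^ 2) * cheb2_coeff (\<lambda>x y. L1 y x) p q"
    using snd_step[OF analytic_sq_transpose[OF L1(1)]] by blast
  have "cheb2_coeff (\<lambda>x y. L2 y x) p q = (1 + of_nat p ^ 2) * (1 + of_nat q ^ 2) * cheb2_coeff K p q" for p q
    using L2(2)[of q p] L1(2)[of p q]
    by (simp add: cheb2_coeff_transpose[OF analytic_sq_continuous[OF analytic_sq_transpose[OF L2(1)]]]
        cheb2_coeff_transpose[OF analytic_sq_continuous[OF L1(1)], symmetric])
  with analytic_sq_transpose[OF L2(1)] show ?thesis by (rule that)
qed

text \<open>Each step trades one eigenvalue factor for a new analytic kernel, hence the induction
  over arbitrary K. At the base, continuity alone bounds the coefficients.\<close>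

lemma cheb2_coeff_decay:
  assumes K: "analytic_sq K"
  shows "\<exists>C. \<forall>p q. norm (cheb2_coeff K p q) * ((1 + real p ^ 2) * (1 + real q ^ 2)) ^ N \<le> C"
  using K
proof (induction N arbitrary: K)
  case 0
  then show ?case using norm_cheb2_coeff_le[OF analytic_sq_continuous] by (metis mult.right_neutral power_0)
next
  case (Suc N)
  obtain L where L: "analytic_sq L"
    "\<And>p q. cheb2_coeff L p q = (1 + of_nat p ^ 2) * (1 + of_nat q ^ 2) * cheb2_coeff K p q"
    by (rule analytic_sq_eigen[OF Suc.prems]) blast
  have n: "norm (1 + of_nat p ^ 2 :: complex) = 1 + real p ^ 2" for p
  proof -
    have "(1 + of_nat p ^ 2 :: complex) = of_real (1 + real p ^ 2)" by simp
    then show ?thesis by (simp only: norm_of_real) simp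
  qed
  show ?case using Suc.IH[OF L(1)] by (simp add: L(2) norm_mult n mult_ac)
qed

text \<open>\<open>p + q + 3\<close> is one more than the bandwidth of the matrix that \<open>c\<^sub>p\<^sub>q\<close> multiplies.\<close>

lemma cheb2_coeff_rapid:
  assumes K: "analytic_sq K"
  shows "(\<lambda>(p, q). norm (cheb2_coeff K p q) * real (p + q + 3) ^ N) summable_on UNIV"
proof -
  \<comment> \<open>One power more than N leaves 1 / ((1 + p^2) (1 + q^2)), which is summable over
    all pairs.\<close>
  obtain C where C: "\<And>p q. norm (cheb2_coeff K p q) * ((1 + real p ^ 2) * (1 + real q ^ 2)) ^ (N + 1) \<le> C"
    using cheb2_coeff_decay[OF K] by blast
  define s where "s = (\<lambda>n::nat. 1 / (1 + real n ^ 2))"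
  have C0: "C \<ge> 0" using order_trans[OF _ C[of 0 0]] by simp
  have "summable (\<lambda>n. s n)"
  proof (rule summable_comparison_test[of _ "\<lambda>n. if n = 0 then 1 else 1 / real n ^ 2"])
    show "\<exists>M. \<forall>n\<ge>M. norm (s n) \<le> (if n = 0 then 1 else 1 / real n ^ 2)"
      by (auto simp: s_def abs_of_nonneg add_nonneg_nonneg add_pos_nonneg intro!: exI[of _ 0] divide_left_mono mult_pos_pos)
    have "summable (\<lambda>n. 1 / real n ^ 2)"
      using inverse_power_summable[of 2, where 'a = real] by (simp add: divide_inverse)
    then show "summable (\<lambda>n. if n = 0 then 1 else 1 / real n ^ 2)"
      by (rule summable_cong[THEN iffD1, rotated]) (auto intro!: eventually_mono[OF eventually_gt_at_top[of 0]])
  qed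
  then have s: "s summable_on UNIV"
    by (subst summable_on_UNIV_nonneg_real_iff) (auto simp: s_def)
  have "(\<lambda>(p, q). s p * s q) summable_on UNIV \<times> UNIV"
  proof (rule summable_on_SigmaI)
    show "((\<lambda>q. case (p, q) of (p, q) \<Rightarrow> s p * s q) has_sum s p * infsum s UNIV) UNIV" for p
      using has_sum_cmult_right[OF has_sum_infsum[OF s], of "s p"] by simp
    show "(\<lambda>p. s p * infsum s UNIV) summable_on UNIV"
      by (rule summable_on_cmult_left[OF s])
  qed (auto simp: s_def)
  then have sum: "(\<lambda>pq. (C * 3 ^ N) * (case pq of (p, q) \<Rightarrow> s p * s q)) summable_on UNIV"
    by (intro summable_on_cmult_right) simp
  have bd: "norm (cheb2_coeff K p q) * real (p + q + 3) ^ N \<le> C * 3 ^ N * (s p * s q)" for p q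
  proof -
    let ?P = "(1 + real p ^ 2) * (1 + real q ^ 2)"
    have P: "?P > 0" by (simp add: add_pos_nonneg)
    have le: "real n \<le> real n ^ 2" for n :: nat by (simp add: power2_eq_square flip: of_nat_mult)
    have "(1 + real p ) * (1 + real q ) \<le> ?P"
      using le by (intro mult_mono) auto
    moreover have "real (p + q + 3) \<le> 3 * ((1 + real p) * (1 + real q))" by (simp add: algebra_simps)
    ultimately have "real (p + q + 3) \<le> 3 * ?P" by linarith
    then have "real (p + q + 3) ^ N \<le> (3 * ?P) ^ N" by (intro power_mono) auto
    then have "norm (cheb2_coeff K p q) * real (p + q + 3) ^ N \<le> norm (cheb2_coeff K p q) * (3 * ?P) ^ N"
      by (intro mult_left_mono) auto
    also have "\<dots> = 3 ^ N * (norm (cheb2_coeff K p q) * ?P ^ (N + 1)) / ?P"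
    proof -
      have "a * (3 * P) ^ N = 3 ^ N * (a * P ^ (N + 1)) / P" if "P > 0" for a P :: real
        using that by (simp add: power_mult_distrib)
      from this[OF P] show ?thesis .
    qed
    also have "\<dots> \<le> 3 ^ N * C / ?P"
      using C[of p q] P by (intro divide_right_mono mult_left_mono) auto
    also have "\<dots> = C * 3 ^ N * (s p * s q)" by (simp add: s_def)
    finally show ?thesis .
  qed
  from sum show ?thesis
    by (rule summable_on_comparison_test) (use bd in auto)
qed

text \<open>The univariate expansion is used twice, in x for every inner coefficient and then in y.
  Absolute summability of the double family supplies both hypotheses and merges the iterated sum
  into one over pairs.\<close>

lemma cheb2_expansion:
  assumes K: "analytic_sq K" and x: "x \<in> {-1..1}" and y: "y \<in> {-1..1}"
  shows "((\<lambda>(p, q). cheb2_coeff K p q * of_real (cheb_T p x * cheb_T q y)) has_sum K x y) UNIV"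
proof -
  note cK = analytic_sq_continuous[OF K]
  have S: "(\<lambda>(q, p). norm (cheb2_coeff K p q)) summable_on UNIV \<times> UNIV"
    using cheb2_coeff_rapid[OF K, of 0] summable_on_swap[of "\<lambda>(p, q). norm (cheb2_coeff K p q)" UNIV UNIV]
    by (simp add: case_prod_unfold)
  define a where "a = (\<lambda>q x. T_coeff (K x) q)"
  have Sp: "(\<lambda>p. norm (cheb2_coeff K p q)) summable_on UNIV" for q
    using summable_on_SigmaD1[OF S, of q] by simp
  have a: "((\<lambda>p. cheb2_coeff K p q * of_real (cheb_T p x)) has_sum a q x) UNIV" if x: "x \<in> {-1..1}" for q x
    using cheb_expansion[OF continuous_on_T_coeff[OF cK] Sp[unfolded cheb2_coeff_def] x]
    by (simp add: a_def cheb2_coeff_def)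
  have bd: "norm (cheb2_coeff K p q * of_real (cheb_T p x)) \<le> norm (cheb2_coeff K p q)" for p q
    using mult_left_mono[OF cheb_T_bound norm_ge_zero[of "cheb2_coeff K p q"], of x p] x
    by (simp add: norm_mult abs_le_iff)
  have "norm (a q x) \<le> (\<Sum>\<^sub>\<infinity>p. norm (cheb2_coeff K p q))" for q
    by (rule norm_infsum_le[OF a[OF x] has_sum_infsum[OF Sp] bd])
  moreover have "(\<lambda>q. \<Sum>\<^sub>\<infinity>p. norm (cheb2_coeff K p q)) summable_on UNIV"
    using summable_on_SigmaD[OF S] Sp by simp
  ultimately have "(\<lambda>q. norm (a q x)) summable_on UNIV"
    by (intro Infinite_Sum.abs_summable_on_comparison_test') auto
  then have E: "((\<lambda>q. a q x * of_real (cheb_T q y)) has_sum K x y) UNIV"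
    using cheb_expansion[OF continuous_on_slice[OF cK x] _ y] by (simp add: a_def)
  have "(\<lambda>z. norm (case z of (q, p) \<Rightarrow> cheb2_coeff K p q * of_real (cheb_T p x * cheb_T q y))) summable_on UNIV \<times> UNIV"
  proof (rule Infinite_Sum.abs_summable_on_comparison_test'[OF S], clarsimp)
    fix q p
    have "\<bar>cheb_T p x * cheb_T q y\<bar> \<le> 1 * 1"
      unfolding abs_mult using x y by (intro mult_mono cheb_T_bound) (auto simp: abs_le_iff)
    from mult_left_mono[OF this norm_ge_zero[of "cheb2_coeff K p q"]]
    show "norm (cheb2_coeff K p q * (of_real (cheb_T p x) * of_real (cheb_T q y))) \<le> norm (cheb2_coeff K p q)"
      by (simp add: norm_mult abs_mult)
  qed
  then have "(\<lambda>(q, p). cheb2_coeff K p q * of_real (cheb_T p x * cheb_T q y)) summable_on UNIV \<times> UNIV"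
    by (rule abs_summable_summable)
  then have "((\<lambda>(q, p). cheb2_coeff K p q * of_real (cheb_T p x * cheb_T q y)) has_sum K x y) (UNIV \<times> UNIV)"
  proof (rule has_sum_SigmaI[rotated 2])
    show "((\<lambda>p. case (q, p) of (q, p) \<Rightarrow> cheb2_coeff K p q * of_real (cheb_T p x * cheb_T q y))
      has_sum a q x * of_real (cheb_T q y)) UNIV" for q
      using has_sum_cmult_left[OF a[OF x, of q], of "of_real (cheb_T q y)"] by (simp add: mult.assoc)
  qed (rule E)
  then show ?thesis
    by (subst (asm) has_sum_swap) (simp add: case_prod_unfold)
qed

subsection \<open>Compactness in weighted sequence spaces\<close>

lemma summable_inverse_Suc_sq: "summable (\<lambda>k. 1 / (real k + 1) ^ 2)"
proof -
  have "summable (\<lambda>k. inverse (real (Suc k) ^ 2))"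
    by (subst summable_Suc_iff) (simp add: inverse_power_summable)
  then show ?thesis by (simp add: divide_inverse add.commute)
qed

lemma powr_double: "(real k + 1) powr (2 * l) = ((real k + 1) powr l)\<^sup>2"
  by (simp add: powr_power mult.commute)

lemma l2w_zero: "(\<lambda>k. 0) \<in> l2w l"
  by (simp add: l2w_def)

lemma l2w_norm_nonneg: "0 \<le> l2w_norm l u"
  by (auto simp: l2w_norm_def intro!: infsum_nonneg)

text \<open>One term is at most the whole sum.\<close>

lemma l2w_coord_le:
  assumes "u \<in> l2w l"
  shows "norm (u k) \<le> l2w_norm l u * (real k + 1) powr - l"
proof -
  let ?f = "\<lambda>k. (norm (u k))\<^sup>2 * (real k + 1) powr (2 * l)"
  have "sum ?f {k} \<le> infsum ?f UNIV"
    using assms by (intro finite_sum_le_infsum) (auto simp: l2w_def)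
  then have "(norm (u k) * (real k + 1) powr l)\<^sup>2 \<le> infsum ?f UNIV"
    by (simp add: powr_double power_mult_distrib)
  then have "norm (u k) * (real k + 1) powr l \<le> l2w_norm l u"
    unfolding l2w_norm_def by (rule real_le_rsqrt)
  then show ?thesis by (simp add: powr_minus field_simps)
qed

text \<open>Explains the exponent -l - 1 of the cube: against the squared weight it leaves the
  summable sequence 1 / (k + 1)^2.\<close>

lemma weighted_sq_le:
  assumes "norm (v k) \<le> M * (real k + 1) powr (- l - 1)"
  shows "(norm (v k))\<^sup>2 * (real k + 1) powr (2 * l) \<le> M\<^sup>2 * (1 / (real k + 1) ^ 2)"
proof -
  have "norm (v k) * (real k + 1) powr l \<le> M * (real k + 1) powr (- l - 1) * (real k + 1) powr l"
    by (intro mult_right_mono assms) auto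
  also have "\<dots> = M * (real k + 1) powr - 1"
    by (simp add: mult.assoc flip: powr_add)
  also have "\<dots> = M / (real k + 1)"
    by (simp add: powr_minus_divide)
  finally have "(norm (v k) * (real k + 1) powr l)\<^sup>2 \<le> (M / (real k + 1))\<^sup>2"
    by (intro power_mono) auto
  then show ?thesis by (simp add: powr_double power_mult_distrib power_divide)
qed

text \<open>The cube is compact for coordinatewise convergence by Tychonoff. On it, the common
  majorant 1 / (k + 1)^2 lets Tannery's theorem turn coordinatewise convergence of a subsequence
  into convergence in norm.\<close>

lemma compactin_cube:
  "compactin (Metric_space.mtopology (l2w l) (l2w_dist l)) {v. \<forall>k. norm (v k) \<le> M * (real k + 1) powr (- l - 1)}"
    (is "compactin _ ?D")
proof -
  interpret Metric_space "l2w l" "l2w_dist l" by (rule Metric_space_l2w)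
  have sub: "v \<in> l2w l" if "\<forall>k. norm (v k) \<le> M' * (real k + 1) powr (- l - 1)" for v M'
  proof -
    have "summable (\<lambda>k. (norm (v k))\<^sup>2 * (real k + 1) powr (2 * l))"
    proof (rule summable_comparison_test')
      show "summable (\<lambda>k. M'\<^sup>2 * (1 / (real k + 1) ^ 2))"
        by (intro summable_mult summable_inverse_Suc_sq)
      show "norm ((norm (v k))\<^sup>2 * (real k + 1) powr (2 * l)) \<le> M'\<^sup>2 * (1 / (real k + 1) ^ 2)" for k
        using weighted_sq_le[of v k M' l] that by simp
    qed
    then show ?thesis
      unfolding l2w_def by (simp add: summable_on_UNIV_nonneg_real_iff)
  qed
  have cpt: "compact ?D"
  proof -
    have "compactin (product_topology (\<lambda>k::nat. euclidean::complex topology) UNIV)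
        (PiE UNIV (\<lambda>k. cball 0 (M * (real k + 1) powr (- l - 1))))"
      by (simp add: compactin_PiE)
    moreover have "PiE UNIV (\<lambda>k. cball 0 (M * (real k + 1) powr (- l - 1))) = ?D"
      by (auto simp: PiE_UNIV_domain Pi_iff)
    ultimately show ?thesis by (simp add: euclidean_product_topology)
  qed
  show ?thesis
    unfolding compactin_sequentially
  proof (intro conjI allI impI)
    show "?D \<subseteq> l2w l" using sub by blast
    fix \<sigma> :: "nat \<Rightarrow> cseq" assume "range \<sigma> \<subseteq> ?D"
    then have \<sigma>: "\<sigma> n \<in> ?D" for n by blast
    obtain L r where L: "L \<in> ?D" and r: "strict_mono r" and lim: "(\<sigma> \<circ> r) \<longlonglongrightarrow> L"
      using compact_imp_seq_compact[OF cpt] \<sigma> by (auto elim!: seq_compactE)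
    have pt: "(\<lambda>n. \<sigma> (r n) k) \<longlonglongrightarrow> L k" for k
      using continuous_on_tendsto_compose[OF continuous_on_product_coordinates lim, of k]
      by (simp add: comp_def)
    let ?a = "\<lambda>k n. (norm (\<sigma> (r n) k - L k))\<^sup>2 * (real k + 1) powr (2 * l)"
    \<comment> \<open>The limit lies in the cube as well, so the distance is at most twice the
      side.\<close>
    have "norm (\<sigma> (r n) k - L k) \<le> 2 * M * (real k + 1) powr (- l - 1)" for n k
      using \<sigma>[of "r n"] L norm_triangle_ineq4[of "\<sigma> (r n) k" "L k"]
      by (auto dest!: spec[of _ k])
    from weighted_sq_le[of "\<lambda>k. \<sigma> (r n) k - L k" for n, OF this]
    have bd: "norm (?a k n) \<le> (2 * M)\<^sup>2 * (1 / (real k + 1) ^ 2)" for k n by simp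
    have "(\<lambda>n. suminf (\<lambda>k. ?a k n)) \<longlonglongrightarrow> suminf (\<lambda>k. 0)"
    proof (rule tannerys_theorem[THEN conjunct2, THEN conjunct2])
      show "(\<lambda>n. ?a k n) \<longlonglongrightarrow> 0" for k
        using tendsto_mult_right[OF tendsto_power[OF tendsto_norm_zero[OF LIM_zero[OF pt[of k]]], of 2], of "(real k + 1) powr (2 * l)"]
        by simp
      show "summable (\<lambda>k. (2 * M)\<^sup>2 * (1 / (real k + 1) ^ 2))"
        by (intro summable_mult summable_inverse_Suc_sq)
    qed (use bd in \<open>auto intro!: always_eventually\<close>)
    moreover have "suminf (\<lambda>k. ?a k n) = (l2w_dist l (\<sigma> (r n)) L)\<^sup>2" for n
    proof -
      have "summable (\<lambda>k. ?a k n)"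
        by (rule summable_comparison_test'[OF summable_mult[OF summable_inverse_Suc_sq] bd])
      have "((\<lambda>k. ?a k n) has_sum suminf (\<lambda>k. ?a k n)) UNIV"
        using \<open>summable (\<lambda>k. ?a k n)\<close> by (intro sums_nonneg_imp_has_sum summable_sums) auto
      then have "suminf (\<lambda>k. ?a k n) = (\<Sum>\<^sub>\<infinity>k. ?a k n)" by (rule infsumI[symmetric])
      also have "\<dots> = (l2w_dist l (\<sigma> (r n)) L)\<^sup>2"
        unfolding l2w_dist_def l2w_norm_def
        by (rule real_sqrt_pow2[symmetric]) (auto intro!: infsum_nonneg)
      finally show ?thesis .
    qed
    ultimately have "(\<lambda>n. (l2w_dist l (\<sigma> (r n)) L)\<^sup>2) \<longlonglongrightarrow> 0" by simp
    then have "(\<lambda>n. sqrt ((l2w_dist l (\<sigma> (r n)) L)\<^sup>2)) \<longlonglongrightarrow> sqrt 0"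
      by (rule tendsto_real_sqrt)
    then have "(\<lambda>n. l2w_dist l (\<sigma> (r n)) L) \<longlonglongrightarrow> 0" by simp
    moreover have "L \<in> l2w l" "\<And>n. \<sigma> n \<in> l2w l" using sub L \<sigma> by blast+
    ultimately have "limitin mtopology (\<sigma> \<circ> r) L sequentially"
      by (simp add: limitin_metric_dist_null comp_def)
    with L r show "\<exists>L r. L \<in> ?D \<and> strict_mono r \<and> limitin mtopology (\<sigma> \<circ> r) L sequentially"
      by blast
  qed
qed

text \<open>Linearity together with a coordinatewise gain of one power of k. Such explicit bounds
  add up and pass through \<open>conv_TU\<close> directly, so compactness has to be derived just
  once, for the total remainder.\<close>

definition smoothing :: "real \<Rightarrow> (cseq \<Rightarrow> cseq) \<Rightarrow> bool" where
  "smoothing l T \<longleftrightarrow>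
     (\<forall>u\<in>l2w l. \<forall>v\<in>l2w l. T (\<lambda>k. u k + v k) = (\<lambda>k. T u k + T v k)) \<and>
     (\<forall>c. \<forall>u\<in>l2w l. T (\<lambda>k. c * u k) = (\<lambda>k. c * T u k)) \<and>
     (\<exists>C\<ge>0. \<forall>u\<in>l2w l. \<forall>k. norm (T u k) \<le> C * l2w_norm l u * (real k + 1) powr (- l - 1))"

text \<open>The image of a bounded set lies in a cube, which is compact and hence closed; the
  closure of the image stays inside it.\<close>

lemma smoothing_compact:
  assumes T: "smoothing l T"
  shows "compact_operator_l2w l T"
proof -
  interpret Metric_space "l2w l" "l2w_dist l" by (rule Metric_space_l2w)
  obtain C where C0: "C \<ge> 0" and C: "\<And>u k. u \<in> l2w l \<Longrightarrow> norm (T u k) \<le> C * l2w_norm l u * (real k + 1) powr (- l - 1)"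
    using T unfolding smoothing_def by meson
  define D where "D = (\<lambda>M. {v::cseq. \<forall>k. norm (v k) \<le> M * (real k + 1) powr (- l - 1)})"
  have D: "compactin mtopology (D M)" for M
    unfolding D_def by (rule compactin_cube)
  have mem: "T u \<in> l2w l" if "u \<in> l2w l" for u
    using compactin_subset_topspace[OF D[of "C * l2w_norm l u"]] C[OF that] by (auto simp: D_def)
  have "compactin mtopology (mtopology closure_of (T ` S))" if "mbounded S" for S
  proof -
    \<comment> \<open>An empty \<open>S\<close> yields no centre in the space, so the zero sequence
      serves as one.\<close>
    have "\<exists>c\<in>l2w l. \<exists>B. \<forall>u\<in>S. u \<in> l2w l \<and> l2w_dist l c u \<le> B"
    proof (cases "S = {}")
      case True
      then show ?thesis using l2w_zero by auto
    next
      case False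
      then show ?thesis using that unfolding mbounded by auto
    qed
    then obtain c B where c: "c \<in> l2w l" "\<And>u. u \<in> S \<Longrightarrow> u \<in> l2w l \<and> l2w_dist l c u \<le> B"
      by auto
    have "T u \<in> D (C * (l2w_norm l c + B))" if u: "u \<in> S" for u
    proof -
      have "l2w_dist l (\<lambda>k. 0) u \<le> l2w_dist l (\<lambda>k. 0) c + l2w_dist l c u"
        using c u by (intro triangle l2w_zero) auto
      then have "l2w_norm l u \<le> l2w_norm l c + B"
        using c(2)[OF u] by (simp add: l2w_dist_def l2w_norm_def)
      then have "C * l2w_norm l u * (real k + 1) powr (- l - 1) \<le> C * (l2w_norm l c + B) * (real k + 1) powr (- l - 1)" for k
        using C0 by (intro mult_right_mono mult_left_mono) auto
      then show ?thesis
        unfolding D_def using C c(2)[OF u] order_trans by blast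
    qed
    then have "mtopology closure_of (T ` S) \<subseteq> D (C * (l2w_norm l c + B))"
      by (intro closure_of_minimal compactin_imp_closedin Hausdorff_space_mtopology D) auto
    then show ?thesis
      by (intro closed_compactin[OF D]) auto
  qed
  with T mem show ?thesis
    unfolding compact_operator_l2w_def smoothing_def by blast
qed

lemma smoothing_add:
  assumes "smoothing l S" "smoothing l T"
  shows "smoothing l (\<lambda>u k. S u k + T u k)"
proof -
  obtain C where C: "C \<ge> 0" "\<And>u k. u \<in> l2w l \<Longrightarrow> norm (S u k) \<le> C * l2w_norm l u * (real k + 1) powr (- l - 1)"
    using assms(1) unfolding smoothing_def by meson
  obtain C' where C': "C' \<ge> 0" "\<And>u k. u \<in> l2w l \<Longrightarrow> norm (T u k) \<le> C' * l2w_norm l u * (real k + 1) powr (- l - 1)"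
    using assms(2) unfolding smoothing_def by meson
  have "norm (S u k + T u k) \<le> (C + C') * l2w_norm l u * (real k + 1) powr (- l - 1)" if "u \<in> l2w l" for u k
    using C(2)[OF that, of k] C'(2)[OF that, of k] norm_triangle_ineq[of "S u k" "T u k"]
    by (simp add: algebra_simps)
  moreover have "C + C' \<ge> 0" using C C' by simp
  ultimately have "\<exists>C\<ge>0. \<forall>u\<in>l2w l. \<forall>k. norm (S u k + T u k) \<le> C * l2w_norm l u * (real k + 1) powr (- l - 1)"
    by blast
  then show ?thesis
    using assms unfolding smoothing_def by (auto simp: algebra_simps)
qed

text \<open>Comparability in both directions is assumed because the exponent may have either sign,
  depending on \<open>l\<close>.\<close>

lemma powr_le_powr_times:
  fixes a b w e :: real
  assumes "a > 0" "b > 0" "w \<ge> 1" "a \<le> w * b" "b \<le> w * a"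
  shows "a powr e \<le> w powr \<bar>e\<bar> * b powr e"
proof (cases "e \<ge> 0")
  case True
  then have "a powr e \<le> (w * b) powr e" using assms by (intro powr_mono2) auto
  with True assms show ?thesis by (simp add: powr_mult)
next
  case False
  have "(w * a) powr e \<le> b powr e"
    using assms False by (intro powr_mono2') auto
  then have "w powr e * a powr e \<le> b powr e" using assms by (simp add: powr_mult)
  then have "w powr - e * (w powr e * a powr e) \<le> w powr - e * b powr e"
    by (intro mult_left_mono) auto
  moreover have "w powr - e * (w powr e * a powr e) = a powr e"
    using assms by (simp add: powr_minus)
  ultimately show ?thesis using False by simp
qed

lemma conv_TU_app: "mat_app conv_TU x k = conv_TU k k * x k + conv_TU k (k + 2) * x (k + 2)"
proof -
  have "((\<lambda>n. conv_TU k n * x n) has_sum (\<Sum>n\<in>{k, k + 2}. conv_TU k n * x n)) UNIV"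
    by (rule has_sum_finite_neutralI[of "{k, k + 2}"]) (auto simp: conv_TU_def)
  from infsumI[OF this] show ?thesis by (simp add: mat_app_def)
qed

lemma smoothing_conv_TU:
  assumes T: "smoothing l T"
  shows "smoothing l (\<lambda>u. mat_app conv_TU (T u))"
proof -
  obtain C where C: "C \<ge> 0" "\<And>u k. u \<in> l2w l \<Longrightarrow> norm (T u k) \<le> C * l2w_norm l u * (real k + 1) powr (- l - 1)"
    using T unfolding smoothing_def by meson
  \<comment> \<open>\<open>conv_TU\<close> couples k with k + 2, and k + 3 \<le> 3 (k + 1) gives the
    base 3.\<close>
  define s where "s = 3 powr \<bar>- l - 1\<bar>"
  have "norm (mat_app conv_TU (T u) k) \<le> (C * (1 + s)) * l2w_norm l u * (real k + 1) powr (- l - 1)"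
    if u: "u \<in> l2w l" for u k
  proof -
    have "(real (k + 2) + 1) powr (- l - 1) \<le> s * (real k + 1) powr (- l - 1)"
      unfolding s_def by (rule powr_le_powr_times) auto
    then have "C * l2w_norm l u * (real (k + 2) + 1) powr (- l - 1) \<le> C * l2w_norm l u * (s * (real k + 1) powr (- l - 1))"
      using C(1) l2w_norm_nonneg by (intro mult_left_mono) auto
    then have 2: "norm (T u (k + 2)) \<le> C * l2w_norm l u * (s * (real k + 1) powr (- l - 1))"
      using C(2)[OF u, of "k + 2"] by linarith
    have "norm (conv_TU k k * T u k) \<le> 1 * norm (T u k)" "norm (conv_TU k (k + 2) * T u (k + 2)) \<le> 1 * norm (T u (k + 2))"
      unfolding norm_mult by (intro mult_right_mono; simp add: conv_TU_def)+
    then have "norm (mat_app conv_TU (T u) k) \<le> norm (T u k) + norm (T u (k + 2))"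
      unfolding conv_TU_app by norm
    then show ?thesis using C(2)[OF u, of k] 2 by (simp add: algebra_simps)
  qed
  moreover have "C * (1 + s) \<ge> 0" using C by (simp add: s_def)
  ultimately have "\<exists>C\<ge>0. \<forall>u\<in>l2w l. \<forall>k. norm (mat_app conv_TU (T u) k) \<le> C * l2w_norm l u * (real k + 1) powr (- l - 1)"
    by blast
  then show ?thesis
    using T unfolding smoothing_def by (auto simp: conv_TU_app algebra_simps)
qed

subsection \<open>Banded matrices\<close>

text \<open>Stated with sums to avoid truncated subtraction. Rows of a banded matrix are finite, so
  \<open>mat_app\<close> is a finite sum on arbitrary sequences and products can be reassociated
  without summability conditions.\<close>

definition banded :: "nat \<Rightarrow> imat \<Rightarrow> bool" where
  "banded w M \<longleftrightarrow> (\<forall>m n. M m n \<noteq> 0 \<longrightarrow> m \<le> n + w \<and> n \<le> m + w)"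

definition mat_mul :: "imat \<Rightarrow> imat \<Rightarrow> imat" where
  "mat_mul M N m n = mat_app M (\<lambda>j. N j n) m"

lemma bandedD: "banded w M \<Longrightarrow> M m n \<noteq> 0 \<Longrightarrow> m \<le> n + w \<and> n \<le> m + w"
  by (simp add: banded_def)

lemma banded_eq_0: "banded w M \<Longrightarrow> n \<notin> {m - w..m + w} \<Longrightarrow> M m n = 0"
  by (rule ccontr) (auto dest!: bandedD)

lemma banded_eq_0': "banded w M \<Longrightarrow> m \<notin> {n - w..n + w} \<Longrightarrow> M m n = 0"
  by (rule ccontr) (auto dest!: bandedD)

lemma banded_mono: "banded w M \<Longrightarrow> w \<le> w' \<Longrightarrow> banded w' M"
  unfolding banded_def by (meson add_left_mono order_trans)

lemma mat_app_banded:
  assumes "banded w M"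
  shows "mat_app M u m = (\<Sum>n\<in>{m - w..m + w}. M m n * u n)"
proof -
  have "((\<lambda>n. M m n * u n) has_sum (\<Sum>n\<in>{m - w..m + w}. M m n * u n)) UNIV"
    by (rule has_sum_finite_neutralI[of "{m - w..m + w}"]) (use banded_eq_0[OF assms] in force)+
  then show ?thesis by (simp add: mat_app_def infsumI)
qed

lemma mat_app_cmult_vec: "mat_app M (\<lambda>k. a * u k) m = a * mat_app M u m"
  by (simp add: mat_app_def mult.left_commute infsum_cmult_right')

lemma banded_mat_mul:
  assumes "banded a M" "banded b N"
  shows "banded (a + b) (mat_mul M N)"
  unfolding banded_def
proof (intro allI impI)
  fix m n assume "mat_mul M N m n \<noteq> 0"
  then obtain j where "M m j * N j n \<noteq> 0"
    unfolding mat_mul_def mat_app_banded[OF assms(1)] by (meson sum.not_neutral_contains_not_neutral)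
  then show "m \<le> n + (a + b) \<and> n \<le> m + (a + b)"
    using bandedD[OF assms(1), of m j] bandedD[OF assms(2), of j n] by auto
qed

lemma mat_app_mat_app:
  assumes M: "banded a M" and N: "banded b N"
  shows "mat_app M (mat_app N u) = mat_app (mat_mul M N) u"
proof
  fix m
  \<comment> \<open>The inner range is enlarged to one independent of j, so that the two finite sums
    can be swapped.\<close>
  have inner: "mat_app N u j = (\<Sum>n\<in>{m - (a + b)..m + (a + b)}. N j n * u n)" if "j \<in> {m - a..m + a}" for j
    unfolding mat_app_banded[OF N]
  proof (rule sum.mono_neutral_left)
    show "{j - b..j + b} \<subseteq> {m - (a + b)..m + (a + b)}" using that by auto
  qed (use banded_eq_0[OF N, of _ j] in auto)
  have "mat_app M (mat_app N u) m
      = (\<Sum>j\<in>{m - a..m + a}. \<Sum>n\<in>{m - (a + b)..m + (a + b)}. M m j * N j n * u n)"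
    unfolding mat_app_banded[OF M] by (intro sum.cong refl) (simp add: inner sum_distrib_left mult.assoc)
  also have "\<dots> = (\<Sum>n\<in>{m - (a + b)..m + (a + b)}. \<Sum>j\<in>{m - a..m + a}. M m j * N j n * u n)"
    by (rule sum.swap)
  also have "\<dots> = mat_app (mat_mul M N) u m"
    unfolding mat_app_banded[OF banded_mat_mul[OF M N]]
    by (simp add: mat_mul_def mat_app_banded[OF M] sum_distrib_right)
  finally show "mat_app M (mat_app N u) m = mat_app (mat_mul M N) u m" .
qed

text \<open>A sum over the at most 2 a + 1 entries of a row of M. The bound for N may depend on the
  column, so a gain of 1 / (n + 1) on the right survives any multiplication from the left.\<close>

lemma norm_mat_mul_le:
  assumes M: "banded a M" and M_le: "\<And>m n. norm (M m n) \<le> \<alpha>" and N_le: "\<And>m n. norm (N m n) \<le> \<beta> n"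
  shows "norm (mat_mul M N m n) \<le> (2 * real a + 1) * \<alpha> * \<beta> n"
proof -
  have \<alpha>: "\<alpha> \<ge> 0" using order_trans[OF norm_ge_zero M_le[of 0 0]] .
  have \<beta>: "\<beta> n \<ge> 0" using order_trans[OF norm_ge_zero N_le[of 0 n]] .
  have "norm (mat_mul M N m n) \<le> of_nat (card {m - a..m + a}) * (\<alpha> * \<beta> n)"
    unfolding mat_mul_def mat_app_banded[OF M]
    by (intro order_trans[OF norm_sum] sum_bounded_above)
      (auto simp: norm_mult intro!: mult_mono M_le N_le \<alpha>)
  also have "\<dots> \<le> (2 * real a + 1) * (\<alpha> * \<beta> n)"
    using \<alpha> \<beta> by (intro mult_right_mono) auto
  finally show ?thesis by (simp add: mult.assoc)
qed

text \<open>Inside the band m + 1 and n + 1 differ by a factor of at most w + 1, so moving the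
  weight from n to m costs a power of w + 1. The \<open>Suc\<close> pays for the number of entries,
  and the exponent is rounded up to match the natural powers in the decay of the
  coefficients.\<close>

lemma band_sum_le:
  assumes f: "\<And>n. m \<le> n + w \<Longrightarrow> n \<le> m + w \<Longrightarrow> f n \<le> B * (real n + 1) powr e" and B: "B \<ge> 0"
  shows "(\<Sum>n\<in>{m - w..m + w}. f n) \<le> 2 * B * real (w + 1) ^ Suc (nat \<lceil>\<bar>e\<bar>\<rceil>) * (real m + 1) powr e"
proof -
  let ?N = "nat \<lceil>\<bar>e\<bar>\<rceil>"
  let ?c = "B * (real (w + 1) ^ ?N * (real m + 1) powr e)"
  have "f n \<le> ?c" if n: "n \<in> {m - w..m + w}" for n
  proof -
    have mw: "m * w \<ge> 0" by simp
    have "n + 1 \<le> (w + 1) * (m + 1)" "m + 1 \<le> (w + 1) * (n + 1)"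
      using n by (auto simp: algebra_simps intro: trans_le_add1 trans_le_add2)
    then have "real (n + 1) \<le> real (w + 1) * real (m + 1)" "real (m + 1) \<le> real (w + 1) * real (n + 1)"
      by (simp_all only: of_nat_mult[symmetric] of_nat_le_iff)
    then have "(real n + 1) powr e \<le> real (w + 1) powr \<bar>e\<bar> * (real m + 1) powr e"
      by (intro powr_le_powr_times) (auto simp: add.commute)
    also have "real (w + 1) powr \<bar>e\<bar> \<le> real (w + 1) powr real ?N"
      by (intro powr_mono) (auto simp: of_nat_ceiling)
    also have "\<dots> = real (w + 1) ^ ?N"
      by (rule powr_realpow) simp
    finally have "(real n + 1) powr e \<le> real (w + 1) ^ ?N * (real m + 1) powr e"
      by (simp add: mult_right_mono)
    then have "B * (real n + 1) powr e \<le> ?c" by (rule mult_left_mono[OF _ B])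
    moreover have "f n \<le> B * (real n + 1) powr e" using n by (intro f) auto
    ultimately show ?thesis by linarith
  qed
  then have "(\<Sum>n\<in>{m - w..m + w}. f n) \<le> of_nat (card {m - w..m + w}) * ?c"
    by (intro sum_bounded_above)
  also have "\<dots> \<le> (2 * real (w + 1)) * ?c"
    using B by (intro mult_right_mono) auto
  finally show ?thesis by (simp only: power_Suc mult_ac)
qed

text \<open>The gain \<open>1 / (n + 1)\<close> in the entries is what makes the sum smoothing.\<close>

lemma smoothing_banded_sum:
  fixes c :: "nat \<Rightarrow> nat \<Rightarrow> complex" and Q :: "nat \<Rightarrow> nat \<Rightarrow> imat"
  assumes c: "\<And>N. (\<lambda>(p, q). norm (c p q) * real (p + q + 3) ^ N) summable_on UNIV"
    and band: "\<And>p q. banded (p + q + 2) (Q p q)"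
    and Q: "\<And>p q m n. norm (Q p q m n) \<le> C * real (p + q + 3) ^ s / (real n + 1)"
    and C: "C \<ge> 0"
  shows "\<And>u m. u \<in> l2w l \<Longrightarrow> (\<lambda>(p, q). c p q * mat_app (Q p q) u m) summable_on UNIV"
    and "smoothing l (\<lambda>u m. \<Sum>\<^sub>\<infinity>(p, q). c p q * mat_app (Q p q) u m)"
proof -
  \<comment> \<open>The total polynomial loss: the transfer of the weight with exponent -l - 1
    across the band, and the growth of the entries.\<close>
  define S where "S = Suc (nat \<lceil>\<bar>- l - 1\<bar>\<rceil>) + s"
  define A where "A = (\<Sum>\<^sub>\<infinity>(p, q). norm (c p q) * real (p + q + 3) ^ S)"
  have A: "((\<lambda>(p, q). norm (c p q) * real (p + q + 3) ^ S) has_sum A) UNIV"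
    unfolding A_def using c by (rule has_sum_infsum)
  have bd: "norm (c p q * mat_app (Q p q) u m)
      \<le> (2 * C * l2w_norm l u * (real m + 1) powr (- l - 1)) * (norm (c p q) * real (p + q + 3) ^ S)"
    if u: "u \<in> l2w l" for u p q m
  proof -
    let ?w = "p + q + 2"
    have "(\<Sum>n\<in>{m - ?w..m + ?w}. norm (Q p q m n * u n))
      \<le> 2 * (C * real (p + q + 3) ^ s * l2w_norm l u) * real (?w + 1) ^ Suc (nat \<lceil>\<bar>- l - 1\<bar>\<rceil>) * (real m + 1) powr (- l - 1)"
    proof (rule band_sum_le)
      fix n
      have "norm (Q p q m n * u n) \<le> (C * real (p + q + 3) ^ s / (real n + 1)) * (l2w_norm l u * (real n + 1) powr - l)"
        unfolding norm_mult using C by (intro mult_mono Q l2w_coord_le u) auto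
      also have "\<dots> = C * real (p + q + 3) ^ s * l2w_norm l u * (real n + 1) powr (- l - 1)"
        by (simp add: powr_diff)
      finally show "norm (Q p q m n * u n) \<le> C * real (p + q + 3) ^ s * l2w_norm l u * (real n + 1) powr (- l - 1)" .
    qed (use C l2w_norm_nonneg in auto)
    also have "\<dots> = 2 * C * l2w_norm l u * (real m + 1) powr (- l - 1) * real (p + q + 3) ^ S"
    proof -
      have "?w + 1 = p + q + 3" by simp
      then show ?thesis by (simp only: S_def power_add power_Suc mult_ac)
    qed
    finally have "norm (mat_app (Q p q) u m) \<le> 2 * C * l2w_norm l u * (real m + 1) powr (- l - 1) * real (p + q + 3) ^ S"
      unfolding mat_app_banded[OF band] by (rule order_trans[OF norm_sum])
    from mult_left_mono[OF this norm_ge_zero[of "c p q"]] show ?thesis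
      by (simp add: norm_mult mult_ac)
  qed
  have abs: "(\<lambda>x. norm (case x of (p, q) \<Rightarrow> c p q * mat_app (Q p q) u m)) summable_on UNIV"
    if u: "u \<in> l2w l" for u m
    by (rule Infinite_Sum.abs_summable_on_comparison_test'[OF summable_on_cmult_right[OF has_sum_imp_summable[OF A],
          of "2 * C * l2w_norm l u * (real m + 1) powr (- l - 1)"]]) (use bd[OF u] in auto)
  show summ: "(\<lambda>(p, q). c p q * mat_app (Q p q) u m) summable_on UNIV" if "u \<in> l2w l" for u m
    using abs[OF that] by (rule abs_summable_summable)
  have A0: "A \<ge> 0" using A by (rule has_sum_nonneg) auto
  have norm_le: "norm (\<Sum>\<^sub>\<infinity>(p, q). c p q * mat_app (Q p q) u m) \<le> (2 * C * A) * l2w_norm l u * (real m + 1) powr (- l - 1)"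
    if u: "u \<in> l2w l" for u m
  proof -
    have "norm (\<Sum>\<^sub>\<infinity>(p, q). c p q * mat_app (Q p q) u m) \<le> (2 * C * l2w_norm l u * (real m + 1) powr (- l - 1)) * A"
      by (rule norm_infsum_le[OF has_sum_infsum[OF summ[OF u]] has_sum_cmult_right[OF A]]) (use bd[OF u] in auto)
    then show ?thesis by (simp add: mult_ac)
  qed
  have "(\<Sum>\<^sub>\<infinity>(p, q). c p q * mat_app (Q p q) (\<lambda>k. u k + v k) m)
      = (\<Sum>\<^sub>\<infinity>(p, q). c p q * mat_app (Q p q) u m) + (\<Sum>\<^sub>\<infinity>(p, q). c p q * mat_app (Q p q) v m)"
    if "u \<in> l2w l" "v \<in> l2w l" for u v m
    using infsum_add[OF summ[OF that(1), of m] summ[OF that(2), of m]]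
    by (simp add: case_prod_unfold mat_app_banded[OF band] distrib_left sum.distrib)
  moreover have "(\<Sum>\<^sub>\<infinity>(p, q). c p q * mat_app (Q p q) (\<lambda>k. a * u k) m)
      = a * (\<Sum>\<^sub>\<infinity>(p, q). c p q * mat_app (Q p q) u m)" for a u m
  proof -
    have "(\<lambda>(p, q). c p q * mat_app (Q p q) (\<lambda>k. a * u k) m) = (\<lambda>x. a * (case x of (p, q) \<Rightarrow> c p q * mat_app (Q p q) u m))"
      by (simp add: fun_eq_iff mat_app_cmult_vec mult.left_commute)
    then show ?thesis by (simp only: infsum_cmult_right')
  qed
  ultimately show "smoothing l (\<lambda>u m. \<Sum>\<^sub>\<infinity>(p, q). c p q * mat_app (Q p q) u m)"
    unfolding smoothing_def using norm_le C A0 by (auto intro!: exI[of _ "2 * C * A"])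
qed

section \<open>Multiplication matrices of Chebyshev polynomials\<close>

definition cheb_mat_T :: "nat \<Rightarrow> imat" where
  "cheb_mat_T p = mult_T (\<lambda>x. of_real (cheb_T p x))"

definition cheb_mat_U :: "nat \<Rightarrow> imat" where
  "cheb_mat_U q = mult_U (\<lambda>x. of_real (cheb_T q x))"

lemma mult_T_cmult: "mult_T (\<lambda>x. a * of_real (cheb_T p x)) m n = a * cheb_mat_T p m n"
  by (simp add: mult_T_def cheb_mat_T_def mult.assoc T_coeff_cmult)

lemma mult_U_cmult: "mult_U (\<lambda>x. a * of_real (cheb_T p x)) m n = a * cheb_mat_U p m n"
  by (simp add: mult_U_def cheb_mat_U_def mult.assoc U_coeff_cmult)

lemma mat_app_cmult: "(\<And>m n. M m n = a * N m n) \<Longrightarrow> mat_app M u m = a * mat_app N u m"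
  by (simp add: mat_app_def mult.assoc infsum_cmult_right')

text \<open>This is T_p T_n = (T_(p+n) + T_|p-n|) / 2, with |p - n| = m split into p + m = n and p =
  m + n. If m = 0, these two coincide, which compensates for the halved normalisation.\<close>

lemma cheb_mat_T_eq:
  "cheb_mat_T p m n = of_real ((if m = 0 then 1 else 2) / 4 *
     (of_bool (p = 0 \<and> n = 0 \<and> m = 0) + of_bool (p + n = m) + of_bool (p + m = n) + of_bool (p = m + n)))"
proof -
  let ?b = "of_bool (int p + int n + int m = 0) + of_bool (int p + int n - int m = 0)
    + of_bool (int p - int n + int m = 0) + of_bool (int p - int n - int m = 0)"
  have "((\<lambda>t. complex_of_real (cos (of_int (int p) * t) * cos (of_int (int n) * t) * cos (of_int (int m) * t)))
      has_integral of_real (pi / 4 * ?b)) {0..pi}"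
    by (intro has_integral_of_real has_integral_cos_cos_cos)
  then have I: "integral {0..pi} (\<lambda>t. complex_of_real (cheb_T p (cos t)) * of_real (cheb_T n (cos t)) * of_real (cos (real m * t)))
      = of_real (pi / 4 * ?b)"
    by (intro integral_unique) (simp add: cheb_T_cos)
  have c: "continuous_on {-1..1} (\<lambda>x. complex_of_real (cheb_T p x) * of_real (cheb_T n x))"
    by (intro continuous_on_mult continuous_on_of_real continuous_on_cheb_T continuous_on_id)
  have b: "?b = of_bool (p = 0 \<and> n = 0 \<and> m = 0) + of_bool (p + n = m) + of_bool (p + m = n) + of_bool (p = m + n)"
    by (intro arg_cong2[where f = "(+)"] arg_cong[where f = of_bool]) linarith+
  show ?thesis
    unfolding cheb_mat_T_def mult_T_def T_coeff_cos[OF c] I b by simp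
qed

lemma U_moment:
  "2 / of_real pi * integral {0..pi} (\<lambda>t. complex_of_real (cos (real p * t)) *
      of_real (sin ((real n + 1) * t) * sin ((real m + 1) * t))) = cheb_mat_U p m n"
proof -
  have c: "continuous_on {-1..1} (\<lambda>x. complex_of_real (cheb_T p x))"
    by (intro continuous_on_of_real continuous_on_cheb_T continuous_on_id)
  show ?thesis
    unfolding cheb_mat_U_def mult_U_def U_coeff_sin[OF c] cheb_T_cos ..
qed

text \<open>This is T_p U_n = (U_(n+p) + U_(n-p)) / 2. Negative indices follow the reflection
  U_(-k-2) = - U_k, the source of the last term.\<close>

lemma cheb_mat_U_eq:
  "cheb_mat_U p m n = of_real ((of_bool (p + n = m) + of_bool (p + m = n) - of_bool (p = m + n + 2)) / 2)"
proof -
  let ?b = "of_bool (int p + int (n + 1) - int (m + 1) = 0) + of_bool (int p - int (n + 1) + int (m + 1) = 0)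
    - of_bool (int p + int (n + 1) + int (m + 1) = 0) - of_bool (int p - int (n + 1) - int (m + 1) = 0)"
  have "((\<lambda>t. complex_of_real (cos (of_int (int p) * t) * (sin (of_int (int (n + 1)) * t) * sin (of_int (int (m + 1)) * t))))
      has_integral of_real (pi / 4 * ?b)) {0..pi}"
    by (intro has_integral_of_real has_integral_cos_sin_sin)
  then have I: "integral {0..pi} (\<lambda>t. complex_of_real (cos (real p * t)) * of_real (sin ((real n + 1) * t) * sin ((real m + 1) * t)))
      = of_real (pi / 4 * ?b)"
    by (intro integral_unique) (simp add: add.commute)
  have b: "?b = of_bool (p + n = m) + of_bool (p + m = n) - 0 - of_bool (p = m + n + 2)"
    by (intro arg_cong2[where f = "(+)"] arg_cong2[where f = "(-)"] arg_cong[where f = of_bool]) (linarith | simp)+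
  show ?thesis
    unfolding U_moment[symmetric] I b by simp
qed

lemma banded_cheb_mat_T: "banded p (cheb_mat_T p)"
  by (auto simp: banded_def cheb_mat_T_eq split: if_splits)

lemma banded_cheb_mat_U: "banded p (cheb_mat_U p)"
  by (auto simp: banded_def cheb_mat_U_eq)

lemma norm_cheb_mat_T: "norm (cheb_mat_T p m n) \<le> 2"
  unfolding cheb_mat_T_eq norm_of_real by (auto simp: of_bool_def)

lemma norm_cheb_mat_U: "norm (cheb_mat_U p m n) \<le> 2"
  unfolding cheb_mat_U_eq norm_of_real by (auto simp: of_bool_def)

text \<open>The finite expansion of T_q U_n in the U basis, written with sines.\<close>

lemma cheb_mat_U_expand:
  "complex_of_real (cos (real q * t)) * of_real (sin ((real n + 1) * t)) =
     (\<Sum>j\<in>{n - q..n + q}. cheb_mat_U q j n * of_real (sin ((real j + 1) * t)))"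
proof -
  have s: "2 * (cos (real q * t) * sin ((real n + 1) * t)) = sin ((real (n + q) + 1) * t) + sin ((real n + 1 - real q) * t)"
    by (simp add: distrib_right left_diff_distrib sin_add sin_diff cos_add cos_diff algebra_simps)
  have "(\<Sum>j\<in>{n - q..n + q}. 2 * cheb_mat_U q j n * of_real (sin ((real j + 1) * t)))
     = (\<Sum>j\<in>{n - q..n + q}. of_real (sin ((real j + 1) * t)) * of_bool (j = n + q))
     + (\<Sum>j\<in>{n - q..n + q}. of_real (sin ((real j + 1) * t)) * of_bool (q + j = n))
     - (\<Sum>j\<in>{n - q..n + q}. of_real (sin ((real j + 1) * t)) * of_bool (q = j + n + 2))"
    unfolding sum.distrib[symmetric] sum_subtractf[symmetric]
    by (intro sum.cong refl) (auto simp: cheb_mat_U_eq algebra_simps)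
  also have "\<dots> = complex_of_real (sin ((real (n + q) + 1) * t) + sin ((real n + 1 - real q) * t))"
  proof -
    have 1: "(\<Sum>j\<in>{n - q..n + q}. complex_of_real (sin ((real j + 1) * t)) * of_bool (j = n + q)) = of_real (sin ((real (n + q) + 1) * t))"
      by (subst sum.mono_neutral_right[of _ "{n + q}"]) auto
    have 2: "(\<Sum>j\<in>{n - q..n + q}. complex_of_real (sin ((real j + 1) * t)) * of_bool (q + j = n))
      = (if q \<le> n then of_real (sin ((real n + 1 - real q) * t)) else 0)"
    proof (cases "q \<le> n")
      case True
      then have "(\<Sum>j\<in>{n - q..n + q}. complex_of_real (sin ((real j + 1) * t)) * of_bool (q + j = n))
        = (\<Sum>j\<in>{n - q}. complex_of_real (sin ((real j + 1) * t)) * of_bool (q + j = n))"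
        by (intro sum.mono_neutral_right) auto
      with True show ?thesis by (simp add: of_nat_diff algebra_simps)
    qed (auto intro!: sum.neutral)
    have 3: "(\<Sum>j\<in>{n - q..n + q}. complex_of_real (sin ((real j + 1) * t)) * of_bool (q = j + n + 2))
      = (if n + 2 \<le> q then - of_real (sin ((real n + 1 - real q) * t)) else 0)"
    proof (cases "n + 2 \<le> q")
      case True
      then obtain k where q: "q = n + 2 + k" using le_Suc_ex by blast
      have "(\<Sum>j\<in>{n - q..n + q}. complex_of_real (sin ((real j + 1) * t)) * of_bool (q = j + n + 2))
        = (\<Sum>j\<in>{k}. complex_of_real (sin ((real j + 1) * t)) * of_bool (q = j + n + 2))"
        by (intro sum.mono_neutral_right) (auto simp: q)
      also have "\<dots> = of_real (sin (- ((real n + 1 - real q) * t)))"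
        by (simp add: q algebra_simps)
      finally show ?thesis using True by simp
    qed (auto intro!: sum.neutral)
    \<comment> \<open>The middle case is the index n - q = -1, where the sine vanishes and neither
      of the last two sums contributes.\<close>
    consider "q \<le> n" | "q = n + 1" | "n + 2 \<le> q" by linarith
    then show ?thesis unfolding 1 2 3 by cases auto
  qed
  also have "\<dots> = 2 * (complex_of_real (cos (real q * t)) * of_real (sin ((real n + 1) * t)))"
    unfolding s[symmetric] by simp
  finally show ?thesis by (simp add: sum_distrib_left[symmetric] mult.assoc)
qed

text \<open>Multiplicativity M_1[T_p] M_1[T_q] = M_1[T_p T_q]. The integral form is the one in which
  the series over p and q can be summed under the integral sign.\<close>

lemma mat_mul_cheb_mat_U:
  "mat_mul (cheb_mat_U p) (cheb_mat_U q) m n = 2 / of_real pi * integral {0..pi}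
     (\<lambda>t. complex_of_real (cos (real p * t)) * of_real (cos (real q * t)) * of_real (sin ((real n + 1) * t) * sin ((real m + 1) * t)))"
proof -
  have i: "((\<lambda>t. complex_of_real (cos (real p * t)) * of_real (sin ((real j + 1) * t) * sin ((real m + 1) * t)))
      has_integral integral {0..pi} (\<lambda>t. complex_of_real (cos (real p * t)) * of_real (sin ((real j + 1) * t) * sin ((real m + 1) * t)))) {0..pi}" for j
    by (intro integrable_integral integrable_continuous_real continuous_intros)
  have "((\<lambda>t. \<Sum>j\<in>{n - q..n + q}. cheb_mat_U q j n * (complex_of_real (cos (real p * t)) * of_real (sin ((real j + 1) * t) * sin ((real m + 1) * t))))
    has_integral (\<Sum>j\<in>{n - q..n + q}. cheb_mat_U q j n * integral {0..pi} (\<lambda>t. complex_of_real (cos (real p * t)) * of_real (sin ((real j + 1) * t) * sin ((real m + 1) * t))))) {0..pi}"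
    by (intro has_integral_sum has_integral_mult_right i) auto
  moreover have "(\<Sum>j\<in>{n - q..n + q}. cheb_mat_U q j n * (complex_of_real (cos (real p * t)) * of_real (sin ((real j + 1) * t) * sin ((real m + 1) * t))))
    = complex_of_real (cos (real p * t)) * of_real (cos (real q * t)) * of_real (sin ((real n + 1) * t) * sin ((real m + 1) * t))" for t
  proof -
    have "complex_of_real (cos (real p * t)) * of_real (cos (real q * t)) * of_real (sin ((real n + 1) * t) * sin ((real m + 1) * t))
      = complex_of_real (cos (real p * t)) * of_real (sin ((real m + 1) * t)) * (of_real (cos (real q * t)) * of_real (sin ((real n + 1) * t)))"
      by (simp add: mult_ac)
    then show ?thesis unfolding cheb_mat_U_expand[of q t n] by (simp add: sum_distrib_left mult_ac)
  qed
  ultimately have "2 / of_real pi * integral {0..pi}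
     (\<lambda>t. complex_of_real (cos (real p * t)) * of_real (cos (real q * t)) * of_real (sin ((real n + 1) * t) * sin ((real m + 1) * t)))
    = (\<Sum>j\<in>{n - q..n + q}. cheb_mat_U q j n * (2 / of_real pi * integral {0..pi} (\<lambda>t. complex_of_real (cos (real p * t)) * of_real (sin ((real j + 1) * t) * sin ((real m + 1) * t)))))"
    by (simp add: integral_unique sum_distrib_left mult.left_commute)
  also have "\<dots> = (\<Sum>j\<in>{n - q..n + q}. cheb_mat_U p m j * cheb_mat_U q j n)"
    unfolding U_moment by (simp add: mult.commute)
  \<comment> \<open>The expansion runs over the column band of the right factor,
    \<open>mat_mul\<close> over the row band of the left one; outside their intersection one of the
    factors is 0.\<close>
  also have "\<dots> = (\<Sum>j\<in>{n - q..n + q} \<inter> {m - p..m + p}. cheb_mat_U p m j * cheb_mat_U q j n)"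
    by (rule sum.mono_neutral_right) (use banded_eq_0[OF banded_cheb_mat_U, of _ m p] in auto)
  also have "\<dots> = (\<Sum>j\<in>{m - p..m + p}. cheb_mat_U p m j * cheb_mat_U q j n)"
    by (rule sum.mono_neutral_left) (use banded_eq_0'[OF banded_cheb_mat_U, of _ n q] in auto)
  finally show ?thesis
    by (simp add: mat_mul_def mat_app_banded[OF banded_cheb_mat_U])
qed

subsection \<open>The preconditioned kernel operators\<close>

text \<open>Under the integral, the double series in cos (p t) cos (q t) is the expansion of K at
  (cos t, cos t), hence the constant \<kappa>. What remains is the orthogonality of the
  sines.\<close>

lemma has_sum_diagonal_entry:
  assumes K: "analytic_sq K" and diag: "\<And>x. x \<in> {-1..1} \<Longrightarrow> K x x = \<kappa>"
  shows "((\<lambda>(p, q). cheb2_coeff K p q * mat_mul (cheb_mat_U p) (cheb_mat_U q) m n)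
    has_sum \<kappa> * of_bool (m = n)) UNIV"
proof -
  define s where "s = (\<lambda>t. complex_of_real (sin ((real n + 1) * t) * sin ((real m + 1) * t)))"
  have s: "norm (s t) \<le> 1" for t
    using mult_mono[OF abs_sin_le_one abs_sin_le_one, of "(real m + 1) * t" "(real n + 1) * t"]
    by (simp add: s_def abs_mult norm_mult)
  let ?f = "\<lambda>pq t. cheb2_coeff K (fst pq) (snd pq) * (complex_of_real (cos (real (fst pq) * t)) * of_real (cos (real (snd pq) * t)) * s t)"
  have "((\<lambda>pq. integral {0..pi} (?f pq)) has_sum integral {0..pi} (\<lambda>t. \<kappa> * s t)) UNIV"
  proof (rule has_sum_integral_Weierstrass(1)[where M = "\<lambda>pq. norm (cheb2_coeff K (fst pq) (snd pq))"])
    show "continuous_on {0..pi} (?f pq)" for pq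
      unfolding s_def by (intro continuous_intros)
    show "(\<lambda>pq. norm (cheb2_coeff K (fst pq) (snd pq))) summable_on UNIV"
      using cheb2_coeff_rapid[OF K, of 0] by (simp add: case_prod_unfold)
    fix t :: real
    show "norm (?f pq t) \<le> norm (cheb2_coeff K (fst pq) (snd pq))" for pq
    proof -
      have "norm (complex_of_real (cos (real (fst pq) * t)) * of_real (cos (real (snd pq) * t)) * s t) \<le> 1 * 1 * 1"
        unfolding norm_mult by (intro mult_mono s) auto
      from mult_left_mono[OF this norm_ge_zero[of "cheb2_coeff K (fst pq) (snd pq)"]]
      show ?thesis by (simp add: norm_mult)
    qed
    have "((\<lambda>(p, q). cheb2_coeff K p q * of_real (cheb_T p (cos t) * cheb_T q (cos t))) has_sum \<kappa>) UNIV"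
      using cheb2_expansion[OF K, of "cos t" "cos t"] diag[of "cos t"] by simp
    from has_sum_cmult_left[OF this, of "s t"]
    show "((\<lambda>pq. ?f pq t) has_sum \<kappa> * s t) UNIV"
      by (simp add: case_prod_unfold cheb_T_cos mult.assoc)
  qed
  from has_sum_cmult_right[OF this, of "2 / of_real pi"]
  have "((\<lambda>pq. 2 / of_real pi * integral {0..pi} (?f pq)) has_sum 2 / of_real pi * integral {0..pi} (\<lambda>t. \<kappa> * s t)) UNIV" .
  moreover have "2 / of_real pi * integral {0..pi} (\<lambda>t. \<kappa> * s t) = \<kappa> * of_bool (m = n)"
  proof -
    have "2 / of_real pi * integral {0..pi} s = cheb_mat_U 0 m n"
      unfolding U_moment[symmetric] s_def by simp
    also have "\<dots> = of_bool (m = n)" by (auto simp: cheb_mat_U_eq)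
    finally show ?thesis by (simp only: integral_mult_right mult.left_commute)
  qed
  moreover have "2 / of_real pi * integral {0..pi} (?f pq)
      = (case pq of (p, q) \<Rightarrow> cheb2_coeff K p q * mat_mul (cheb_mat_U p) (cheb_mat_U q) m n)" for pq
    by (simp only: integral_mult_right case_prod_unfold mat_mul_cheb_mat_U s_def mult.left_commute)
  ultimately show ?thesis by simp
qed

text \<open>Passing from entries to the action on u exchanges the sum over p, q with the row sum
  over n. This takes absolute summability over all triples, which the rapid decay of the
  coefficients provides although the entries carry no gain in n.\<close>

lemma has_sum_diagonal:
  assumes K: "analytic_sq K" and diag: "\<And>x. x \<in> {-1..1} \<Longrightarrow> K x x = \<kappa>" and u: "u \<in> l2w l"
  shows "((\<lambda>(p, q). cheb2_coeff K p q * mat_app (mat_mul (cheb_mat_U p) (cheb_mat_U q)) u m)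
    has_sum \<kappa> * u m) UNIV"
proof -
  define G where "G = (\<lambda>pq. mat_mul (cheb_mat_U (fst pq)) (cheb_mat_U (snd pq)))"
  define c where "c = (\<lambda>pq. cheb2_coeff K (fst pq) (snd pq))"
  define w where "w = (\<lambda>pq::nat \<times> nat. fst pq + snd pq + 2)"
  have band: "banded (w pq) (G pq)" for pq
    unfolding G_def w_def
    by (rule banded_mono[OF banded_mat_mul[OF banded_cheb_mat_U banded_cheb_mat_U]]) simp
  have G: "norm (G pq m n) \<le> 8 * real (w pq + 1)" for pq m n
  proof -
    have "norm (G pq m n) \<le> (2 * real (fst pq) + 1) * 2 * 2"
      unfolding G_def by (rule norm_mat_mul_le[OF banded_cheb_mat_U norm_cheb_mat_U norm_cheb_mat_U])
    then show ?thesis by (simp add: w_def)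
  qed
  define h where "h = (\<lambda>(pq, n). c pq * (G pq m n * u n))"
  define S where "S = (\<lambda>pq. \<Sum>n\<in>{m - w pq..m + w pq}. norm (h (pq, n)))"
  \<comment> \<open>The extra 1 accounts for the entries, which grow linearly in the bandwidth; the
    rest is the loss in \<open>band_sum_le\<close>.\<close>
  define N where "N = Suc (nat \<lceil>\<bar>- l\<bar>\<rceil>) + 1"
  have le: "S pq \<le> (16 * l2w_norm l u * (real m + 1) powr - l) * (norm (c pq) * real (w pq + 1) ^ N)" for pq
  proof -
    have "S pq \<le> 2 * (norm (c pq) * (8 * real (w pq + 1)) * l2w_norm l u) * real (w pq + 1) ^ Suc (nat \<lceil>\<bar>- l\<bar>\<rceil>) * (real m + 1) powr - l"
      unfolding S_def
    proof (rule band_sum_le)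
      fix n
      have "norm (h (pq, n)) \<le> norm (c pq) * ((8 * real (w pq + 1)) * (l2w_norm l u * (real n + 1) powr - l))"
        unfolding h_def prod.case norm_mult
        by (intro mult_left_mono mult_mono G l2w_coord_le u) auto
      then show "norm (h (pq, n)) \<le> norm (c pq) * (8 * real (w pq + 1)) * l2w_norm l u * (real n + 1) powr - l"
        by (simp only: mult.assoc)
    qed (use l2w_norm_nonneg in auto)
    also have "\<dots> = (16 * l2w_norm l u * (real m + 1) powr - l) * (norm (c pq) * real (w pq + 1) ^ N)"
      by (simp add: N_def power_add)
    finally show ?thesis .
  qed
  have "(\<lambda>pq. norm (c pq) * real (w pq + 1) ^ N) summable_on UNIV"
    using cheb2_coeff_rapid[OF K, of N] by (simp add: case_prod_unfold c_def w_def algebra_simps)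
  from summable_on_cmult_right[OF this, of "16 * l2w_norm l u * (real m + 1) powr - l"]
  have S: "S summable_on UNIV"
    by (rule summable_on_comparison_test) (rule le, simp add: S_def sum_nonneg)
  have h0: "h (pq, n) = 0" if "n \<notin> {m - w pq..m + w pq}" for pq n
    using banded_eq_0[OF band that] by (simp add: h_def)
  have "(\<lambda>x. norm (h x)) summable_on UNIV \<times> UNIV"
  proof (rule summable_on_SigmaI[OF _ S])
    show "((\<lambda>n. norm (h (pq, n))) has_sum S pq) UNIV" for pq
      by (rule has_sum_finite_neutralI[of "{m - w pq..m + w pq}"]) (auto simp: S_def intro!: h0)
  qed auto
  then have "h summable_on UNIV \<times> UNIV" by (rule abs_summable_summable)
  then obtain X where X: "(h has_sum X) (UNIV \<times> UNIV)"
    unfolding summable_on_def by (rule exE)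
  have slice: "((\<lambda>n. h (pq, n)) has_sum c pq * mat_app (G pq) u m) UNIV" for pq
  proof -
    have "((\<lambda>n. h (pq, n)) has_sum (\<Sum>n\<in>{m - w pq..m + w pq}. h (pq, n))) UNIV"
      by (rule has_sum_finite_neutralI[of "{m - w pq..m + w pq}"]) (auto intro!: h0)
    then show ?thesis by (simp add: mat_app_banded[OF band] h_def sum_distrib_left)
  qed
  \<comment> \<open>The total \<open>X\<close> is evaluated in two orders: summing over n first
    gives the series in question, summing over p, q first gives \<kappa> times the identity.\<close>
  have 1: "((\<lambda>pq. c pq * mat_app (G pq) u m) has_sum X) UNIV"
    by (rule has_sum_Sigma'[OF X slice])
  have "((\<lambda>(n, pq). h (pq, n)) has_sum X) (UNIV \<times> UNIV)"
    using X by (subst (asm) has_sum_swap)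
  then have 2: "((\<lambda>n. \<kappa> * of_bool (m = n) * u n) has_sum X) UNIV"
  proof (rule has_sum_Sigma')
    fix n
    have "((\<lambda>pq. c pq * G pq m n) has_sum \<kappa> * of_bool (m = n)) UNIV"
      using has_sum_diagonal_entry[OF K diag, of m n] by (simp add: case_prod_unfold c_def G_def)
    from has_sum_cmult_left[OF this, of "u n"]
    show "((\<lambda>pq. case (n, pq) of (n, pq) \<Rightarrow> h (pq, n)) has_sum \<kappa> * of_bool (m = n) * u n) UNIV"
      by (simp add: h_def mult.assoc)
  qed
  have "((\<lambda>n. \<kappa> * of_bool (m = n) * u n) has_sum \<kappa> * u m) UNIV"
    by (rule has_sum_finite_neutralI[of "{m}"]) auto
  with 2 have "X = \<kappa> * u m" by (rule has_sum_unique)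
  with 1 show ?thesis by (simp add: case_prod_unfold c_def G_def)
qed

lemma mat_mul_diag_right:
  assumes "\<And>m n. D m n = (if m = n then d n else 0)"
  shows "mat_mul M D m n = M m n * d n"
proof -
  have "((\<lambda>j. M m j * D j n) has_sum M m n * d n) UNIV"
    by (rule has_sum_finite_neutralI[of "{n}"]) (auto simp: assms)
  then show ?thesis by (simp add: mat_mul_def mat_app_def infsumI)
qed

lemma mat_mul_diag_left:
  assumes "\<And>m n. D m n = (if m = n then d n else 0)"
  shows "mat_mul D M m n = d m * M m n"
proof -
  have "((\<lambda>j. D m j * M j n) has_sum d m * M m n) UNIV"
    by (rule has_sum_finite_neutralI[of "{m}"]) (auto simp: assms)
  then show ?thesis by (simp add: mat_mul_def mat_app_def infsumI)
qed

lemma banded_precond: "banded 0 precond_mat"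
  by (auto simp: banded_def precond_mat_def)

lemma banded_hadamard: "banded 0 hadamard_mat"
  by (auto simp: banded_def hadamard_mat_def)

lemma norm_Suc: "norm (complex_of_nat n + 1) = real n + 1"
proof -
  have "complex_of_nat n + 1 = of_real (real n + 1)" by simp
  then show ?thesis unfolding \<open>_ = of_real _\<close> norm_of_real by simp
qed

text \<open>The matrix \<open>E\<close> stands for \<open>cheb_mat_T\<close> or
  \<open>cheb_mat_U\<close>, so one computation serves all three operators. Merging the four factors
  leaves a single banded matrix whose entries can be bounded.\<close>

lemma kernel_term_precond:
  assumes M: "\<And>a p m n. M (\<lambda>x. a * of_real (cheb_T p x)) m n = a * E p m n"
    and E: "\<And>p. banded p (E p)" and D: "banded d D"
  shows "kernel_term M D K (mat_app precond_mat u) (p, q) m = cheb2_coeff K p q *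
    mat_app (mat_mul (E p) (mat_mul D (mat_mul (cheb_mat_U q) precond_mat))) u m"
proof -
  note UR = banded_mat_mul[OF banded_cheb_mat_U[of q] banded_precond]
  have "kernel_term M D K (mat_app precond_mat u) (p, q) m = cheb2_coeff K p q *
    mat_app (E p) (mat_app D (mat_app (cheb_mat_U q) (mat_app precond_mat u))) m"
    unfolding kernel_term_def prod.case cheb_mat_U_def[symmetric] by (rule mat_app_cmult) (rule M)
  also have "mat_app (E p) (mat_app D (mat_app (cheb_mat_U q) (mat_app precond_mat u)))
      = mat_app (mat_mul (E p) (mat_mul D (mat_mul (cheb_mat_U q) precond_mat))) u"
    by (simp only: mat_app_mat_app[OF banded_cheb_mat_U banded_precond]
        mat_app_mat_app[OF D UR] mat_app_mat_app[OF E banded_mat_mul[OF D UR]])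
  finally show ?thesis .
qed

text \<open>For the logarithmic and the smooth part alike, \<open>D\<close> is bounded with a narrow
  band, and the whole gain 1 / (n + 1) comes from the preconditioner.\<close>

lemma smoothing_kernel_op_T:
  assumes K: "analytic_sq K" and D: "banded 2 D" "\<And>m n. norm (D m n) \<le> 1"
  shows "\<And>u. u \<in> l2w l \<Longrightarrow> kernel_converges mult_T D K (mat_app precond_mat u)"
    and "smoothing l (\<lambda>u. kernel_op mult_T D K (mat_app precond_mat u))"
proof -
  define Q where "Q = (\<lambda>p q. mat_mul (cheb_mat_T p) (mat_mul D (mat_mul (cheb_mat_U q) precond_mat)))"
  have kt: "kernel_term mult_T D K (mat_app precond_mat u) = (\<lambda>(p, q) m. cheb2_coeff K p q * mat_app (Q p q) u m)" for u
    using kernel_term_precond[where M = mult_T and E = cheb_mat_T, OF mult_T_cmult banded_cheb_mat_T D(1)]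
    by (simp add: fun_eq_iff Q_def)
  have band: "banded (p + q + 2) (Q p q)" for p q
    unfolding Q_def
    by (rule banded_mono[OF banded_mat_mul[OF banded_cheb_mat_T banded_mat_mul[OF D(1)
            banded_mat_mul[OF banded_cheb_mat_U banded_precond]]]]) simp
  \<comment> \<open>Entries are at most 4 / (n + 1) after the preconditioner and 5 times that after
    \<open>D\<close> of bandwidth 2. The left factor contributes 2 (2 p + 1), and 2 p + 1 is at most
    twice the square of p + q + 3; hence 80.\<close>
  have norm_Q: "norm (Q p q m n) \<le> 80 * real (p + q + 3) ^ 2 / (real n + 1)" for p q m n
  proof -
    have "norm (mat_mul (cheb_mat_U q) precond_mat m n) \<le> 4 / (real n + 1)" for m n
    proof -
      have "mat_mul (cheb_mat_U q) precond_mat m n = cheb_mat_U q m n * (- 2 / (of_nat n + 1))"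
        by (rule mat_mul_diag_right) (simp add: precond_mat_def)
      then have "norm (mat_mul (cheb_mat_U q) precond_mat m n) = norm (cheb_mat_U q m n) * (2 / (real n + 1))"
        by (simp add: norm_mult norm_divide norm_Suc)
      also have "\<dots> \<le> 2 * (2 / (real n + 1))"
        by (intro mult_right_mono norm_cheb_mat_U) auto
      finally show ?thesis by simp
    qed
    from norm_mat_mul_le[OF D this]
    have "norm (mat_mul D (mat_mul (cheb_mat_U q) precond_mat) m n) \<le> 20 / (real n + 1)" for m n by simp
    from norm_mat_mul_le[OF banded_cheb_mat_T[of p] norm_cheb_mat_T this]
    have "norm (Q p q m n) \<le> (2 * real p + 1) * 40 / (real n + 1)" by (simp add: Q_def)
    also have "(2 * real p + 1) \<le> 2 * real (p + q + 3) ^ 2"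
    proof -
      have "real (p + q + 3) * 1 \<le> real (p + q + 3) * real (p + q + 3)"
        by (intro mult_left_mono) auto
      moreover have "2 * real p + 1 \<le> 2 * real (p + q + 3)" by simp
      ultimately show ?thesis unfolding power2_eq_square by linarith
    qed
    then have "(2 * real p + 1) * 40 / (real n + 1) \<le> 2 * real (p + q + 3) ^ 2 * 40 / (real n + 1)"
      by (intro divide_right_mono mult_right_mono) auto
    finally show ?thesis by simp
  qed
  note sums = smoothing_banded_sum[where c = "cheb2_coeff K" and Q = Q and C = 80 and s = 2 and l = l, OF cheb2_coeff_rapid[OF K] band norm_Q]
  show "kernel_converges mult_T D K (mat_app precond_mat u)" if "u \<in> l2w l" for u
    using sums(1)[OF _ that] by (simp add: kernel_converges_def kt case_prod_unfold)
  show "smoothing l (\<lambda>u. kernel_op mult_T D K (mat_app precond_mat u))"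
    using sums(2) by (simp add: kernel_op_def kt case_prod_unfold)
qed

section \<open>The Hadamard part\<close>

text \<open>Commuting the preconditioner past \<open>cheb_mat_U q\<close> costs the factor \<open>(m - n) / (n + 1)\<close>,
  which is bounded by \<open>q / (n + 1)\<close> inside the band.\<close>

definition hadamard_commutator :: "nat \<Rightarrow> imat" where
  "hadamard_commutator q m n = 2 * (of_nat m - of_nat n) / (of_nat n + 1) * cheb_mat_U q m n"

text \<open>Row m is scaled by -(m + 1) and column n by -2 / (n + 1), and (m + 1) / (n + 1) = 1 + (m
  - n) / (n + 1).\<close>

lemma hadamard_precond_eq:
  "mat_mul hadamard_mat (mat_mul (cheb_mat_U q) precond_mat) m n = 2 * cheb_mat_U q m n + hadamard_commutator q m n"
proof -
  have "mat_mul hadamard_mat (mat_mul (cheb_mat_U q) precond_mat) m n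
      = - (of_nat m + 1) * (cheb_mat_U q m n * (- 2 / (of_nat n + 1)))"
    by (subst mat_mul_diag_left[of _ "\<lambda>n. - (of_nat n + 1)"], simp add: hadamard_mat_def)
      (subst mat_mul_diag_right[of _ "\<lambda>n. - 2 / (of_nat n + 1)"], simp_all add: precond_mat_def)
  moreover have "complex_of_nat n + 1 \<noteq> 0"
    using norm_Suc[of n] by (auto simp: complex_eq_iff)
  ultimately show ?thesis by (simp add: hadamard_commutator_def field_simps)
qed

lemma banded_hadamard_commutator: "banded q (hadamard_commutator q)"
  using bandedD[OF banded_cheb_mat_U] by (auto simp: banded_def hadamard_commutator_def)

lemma norm_hadamard_commutator: "norm (hadamard_commutator q m n) \<le> 4 * real q / (real n + 1)"
proof (cases "cheb_mat_U q m n = 0")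
  case False
  have "norm (of_nat m - of_nat n :: complex) = \<bar>real m - real n\<bar>"
  proof -
    have "of_nat m - of_nat n = complex_of_real (real m - real n)" by simp
    then show ?thesis by (simp only: norm_of_real)
  qed
  also have "\<dots> \<le> real q" using bandedD[OF banded_cheb_mat_U False] by linarith
  finally have d: "norm (of_nat m - of_nat n :: complex) \<le> real q" .
  have "norm (hadamard_commutator q m n) = 2 * norm (of_nat m - of_nat n :: complex) / (real n + 1) * norm (cheb_mat_U q m n)"
    unfolding hadamard_commutator_def norm_mult norm_divide norm_Suc by simp
  also have "\<dots> \<le> 2 * real q / (real n + 1) * 2"
    using d by (intro mult_mono divide_right_mono norm_cheb_mat_U) auto
  finally show ?thesis by simp
qed (simp add: hadamard_commutator_def)

text \<open>The diagonal value 1/2 cancels the factor 2 left by the two diagonal matrices, which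
  produces exactly the identity; the commutators form \<open>T\<close>.\<close>

lemma hadamard_op_precond:
  assumes K: "analytic_sq K" and diag: "\<And>x. x \<in> {-1..1} \<Longrightarrow> K x x = 1 / 2"
  obtains T where "smoothing l T"
    and "\<And>u. u \<in> l2w l \<Longrightarrow> kernel_converges mult_U hadamard_mat K (mat_app precond_mat u)"
    and "\<And>u m. u \<in> l2w l \<Longrightarrow> hadamard_op K (mat_app precond_mat u) m = u m + T u m"
proof -
  define Q where "Q = (\<lambda>p q. mat_mul (cheb_mat_U p) (hadamard_commutator q))"
  define T where "T = (\<lambda>u m. \<Sum>\<^sub>\<infinity>(p, q). cheb2_coeff K p q * mat_app (Q p q) u m)"
  have band: "banded (p + q + 2) (Q p q)" for p q
    unfolding Q_def by (rule banded_mono[OF banded_mat_mul[OF banded_cheb_mat_U banded_hadamard_commutator]]) simp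
  have norm_Q: "norm (Q p q m n) \<le> 16 * real (p + q + 3) ^ 2 / (real n + 1)" for p q m n
  proof -
    have "norm (Q p q m n) \<le> (2 * real p + 1) * 2 * (4 * real q / (real n + 1))"
      unfolding Q_def by (rule norm_mat_mul_le[OF banded_cheb_mat_U norm_cheb_mat_U norm_hadamard_commutator])
    also have "\<dots> = 8 * ((2 * real p + 1) * real q) / (real n + 1)" by simp
    also have "(2 * real p + 1) * real q \<le> (2 * real (p + q + 3)) * real (p + q + 3)"
      by (intro mult_mono) auto
    then have "8 * ((2 * real p + 1) * real q) / (real n + 1) \<le> 8 * ((2 * real (p + q + 3)) * real (p + q + 3)) / (real n + 1)"
      by (intro divide_right_mono mult_left_mono) auto
    also have "8 * ((2 * real (p + q + 3)) * real (p + q + 3)) = 16 * real (p + q + 3) ^ 2"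
      by (simp only: power2_eq_square)
    finally show ?thesis .
  qed
  note sums = smoothing_banded_sum[where c = "cheb2_coeff K" and Q = Q and C = 16 and s = 2 and l = l, OF cheb2_coeff_rapid[OF K] band norm_Q]
  have kt: "kernel_term mult_U hadamard_mat K (mat_app precond_mat u) (p, q) m =
      2 * (cheb2_coeff K p q * mat_app (mat_mul (cheb_mat_U p) (cheb_mat_U q)) u m)
      + cheb2_coeff K p q * mat_app (Q p q) u m" for u p q m
  proof -
    have eq: "mat_mul (cheb_mat_U p) (mat_mul hadamard_mat (mat_mul (cheb_mat_U q) precond_mat)) m n
      = 2 * mat_mul (cheb_mat_U p) (cheb_mat_U q) m n + Q p q m n" for m n
      by (simp add: mat_mul_def[of "cheb_mat_U p"] Q_def mat_app_banded[OF banded_cheb_mat_U]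
          hadamard_precond_eq distrib_left sum.distrib sum_distrib_left mult_ac)
    have "mat_app (mat_mul (cheb_mat_U p) (mat_mul hadamard_mat (mat_mul (cheb_mat_U q) precond_mat))) u m
      = 2 * mat_app (mat_mul (cheb_mat_U p) (cheb_mat_U q)) u m + mat_app (Q p q) u m"
    proof -
      have b1: "banded (p + q + 2) (mat_mul (cheb_mat_U p) (mat_mul hadamard_mat (mat_mul (cheb_mat_U q) precond_mat)))"
        by (rule banded_mono[OF banded_mat_mul[OF banded_cheb_mat_U banded_mat_mul[OF banded_hadamard
            banded_mat_mul[OF banded_cheb_mat_U banded_precond]]]]) simp
      have b2: "banded (p + q + 2) (mat_mul (cheb_mat_U p) (cheb_mat_U q))"
        by (rule banded_mono[OF banded_mat_mul[OF banded_cheb_mat_U banded_cheb_mat_U]]) simp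
      show ?thesis
        unfolding mat_app_banded[OF b1] mat_app_banded[OF b2] mat_app_banded[OF band] eq
        by (simp only: distrib_right sum.distrib sum_distrib_left mult.assoc)
    qed
    then show ?thesis
      by (simp add: kernel_term_precond[where M = mult_U and E = cheb_mat_U, OF mult_U_cmult banded_cheb_mat_U banded_hadamard]
          distrib_left)
  qed
  \<comment> \<open>One \<open>has_sum\<close> statement yields both the convergence of the kernel
    series and its value.\<close>
  have hs: "((\<lambda>pq. kernel_term mult_U hadamard_mat K (mat_app precond_mat u) pq m) has_sum u m + T u m) UNIV"
    if u: "u \<in> l2w l" for u m
  proof -
    have "((\<lambda>pq. 2 * (case pq of (p, q) \<Rightarrow> cheb2_coeff K p q * mat_app (mat_mul (cheb_mat_U p) (cheb_mat_U q)) u m)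
      + (case pq of (p, q) \<Rightarrow> cheb2_coeff K p q * mat_app (Q p q) u m)) has_sum 2 * (1 / 2 * u m) + T u m) UNIV"
      unfolding T_def
      by (intro has_sum_add has_sum_cmult_right has_sum_diagonal[OF K diag u] has_sum_infsum sums(1) u) auto
    moreover have "kernel_term mult_U hadamard_mat K (mat_app precond_mat u) pq m
      = 2 * (case pq of (p, q) \<Rightarrow> cheb2_coeff K p q * mat_app (mat_mul (cheb_mat_U p) (cheb_mat_U q)) u m)
      + (case pq of (p, q) \<Rightarrow> cheb2_coeff K p q * mat_app (Q p q) u m)" for pq
      by (cases pq) (simp only: kt prod.case)
    ultimately show ?thesis by simp
  qed
  show ?thesis
  proof (rule that[of T])
    show "smoothing l T" unfolding T_def by (rule sums(2)) simp
    show "kernel_converges mult_U hadamard_mat K (mat_app precond_mat u)" if "u \<in> l2w l" for u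
      unfolding kernel_converges_def using hs[OF that] has_sum_imp_summable by blast
    show "hadamard_op K (mat_app precond_mat u) m = u m + T u m" if "u \<in> l2w l" for u m
      unfolding kernel_op_def using hs[OF that] by (rule infsumI)
  qed
qed

theorem lemma14:
  fixes A B \<Phi> :: "real \<times> real \<Rightarrow> real \<times> real \<Rightarrow> complex"
    and W :: "(real \<times> real) set"
    and l :: real
  assumes "open W" and "{-1..1} \<times> {0} \<subseteq> W"
    and "analytic_pair_on A W" and "analytic_pair_on B W"
    and "\<And>x. x \<in> W \<Longrightarrow> A x x = - 1 / (2 * of_real pi)"
    and "\<And>x y. x \<in> W \<Longrightarrow> y \<in> W \<Longrightarrow> x \<noteq> y \<Longrightarrow>
           \<Phi> x y = A x y * of_real (ln (norm (x - y))) + B x y"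
  shows
    "(\<forall>u\<in>l2w l.
        kernel_converges mult_U hadamard_mat (\<lambda>x y. - of_real pi * on_line A x y)
          (mat_app precond_mat u) \<and>
        kernel_converges mult_T log_mat (\<lambda>x y. of_real pi * d2_on_line A x y)
          (mat_app precond_mat u) \<and>
        kernel_converges mult_T sigma_mat (\<lambda>x y. of_real pi * d2_on_line B x y)
          (mat_app precond_mat u)) \<and>
     (\<exists>\<K>. compact_operator_l2w l \<K> \<and>
       (\<forall>u\<in>l2w l. \<forall>k.
          hadamard_op (\<lambda>x y. - of_real pi * on_line A x y) (mat_app precond_mat u) k +
          mat_app conv_TU
            (\<lambda>j. log_op (\<lambda>x y. of_real pi * d2_on_line A x y) (mat_app precond_mat u) j +
                 sigma_op (\<lambda>x y. of_real pi * d2_on_line B x y) (mat_app precond_mat u) j) k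
          = u k + \<K> u k))"
proof -
  note W = assms(2)
  have A: "analytic_sq (\<lambda>x y. - of_real pi * on_line A x y)"
    by (rule analytic_sq_cmult[OF analytic_sq_on_line[OF W assms(3)]])
  have A2: "analytic_sq (\<lambda>x y. of_real pi * d2_on_line A x y)"
    by (rule analytic_sq_cmult[OF analytic_sq_d2_on_line[OF W assms(3)]])
  have B2: "analytic_sq (\<lambda>x y. of_real pi * d2_on_line B x y)"
    by (rule analytic_sq_cmult[OF analytic_sq_d2_on_line[OF W assms(4)]])
  \<comment> \<open>The normalisation of A on the diagonal enters here: -\<pi> times -1 / (2 \<pi>)
    is 1/2.\<close>
  have diag: "- of_real pi * on_line A x x = 1 / 2" if "x \<in> {-1..1}" for x
  proof -
    have "(x, 0) \<in> W" using W that by auto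
    then show ?thesis by (simp add: on_line_def assms(5))
  qed
  obtain T where T: "smoothing l T"
    and conv: "\<And>u. u \<in> l2w l \<Longrightarrow>
      kernel_converges mult_U hadamard_mat (\<lambda>x y. - of_real pi * on_line A x y) (mat_app precond_mat u)"
    and H: "\<And>u m. u \<in> l2w l \<Longrightarrow>
      hadamard_op (\<lambda>x y. - of_real pi * on_line A x y) (mat_app precond_mat u) m = u m + T u m"
    by (rule hadamard_op_precond[OF A diag]) blast+
  have log: "banded 2 log_mat" "norm (log_mat m n) \<le> 1" for m n
  proof -
    show "banded 2 log_mat" by (auto simp: banded_def log_mat_def split: if_splits)
    \<comment> \<open>Needed for the corner entry -ln 2 / 2, the one entry of \<open>log_mat\<close>
      that is not rational.\<close>
    have "ln 2 \<le> (2::real)" using ln_le_minus_one[of "2::real"] by simp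
    moreover have "norm (2 * (of_nat n + 2) :: complex) = 2 * (real n + 2)"
    proof -
      have "2 * (of_nat n + 2) = complex_of_real (2 * (real n + 2))" by simp
      then show ?thesis by (simp only: norm_of_real) simp
    qed
    ultimately show "norm (log_mat m n) \<le> 1"
      by (auto simp: log_mat_def norm_divide norm_mult divide_le_eq)
  qed
  \<comment> \<open>The band is widened to 2 so that \<open>sigma_mat\<close> falls under the same
    lemma as \<open>log_mat\<close>.\<close>
  have sigma: "banded 2 sigma_mat" "norm (sigma_mat m n) \<le> 1" for m n
    by (auto simp: banded_def sigma_mat_def)
  note L = smoothing_kernel_op_T[OF A2 log, where l = l]
  note S = smoothing_kernel_op_T[OF B2 sigma, where l = l]
  define R where "R = (\<lambda>u. mat_app conv_TU
    (\<lambda>j. log_op (\<lambda>x y. of_real pi * d2_on_line A x y) (mat_app precond_mat u) j +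
         sigma_op (\<lambda>x y. of_real pi * d2_on_line B x y) (mat_app precond_mat u) j))"
  have "smoothing l (\<lambda>u k. T u k + R u k)"
    unfolding R_def by (intro smoothing_add[OF T] smoothing_conv_TU smoothing_add L(2) S(2))
  then have "compact_operator_l2w l (\<lambda>u k. T u k + R u k)"
    by (rule smoothing_compact)
  moreover have "hadamard_op (\<lambda>x y. - of_real pi * on_line A x y) (mat_app precond_mat u) k + R u k
      = u k + (T u k + R u k)" if "u \<in> l2w l" for u k
    unfolding H[OF that] by simp
  ultimately show ?thesis
    using conv L(1) S(1) unfolding R_def by blast
qed

end
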